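(* (In ZFC.) There exists a $+$-Ramsey MAD family on $\omega$.
   Context: A family $\mathcal{A}\subseteq[\omega]^\omega$ is almost disjoint (AD) if any two distinct members have finite intersection; a MAD family is a maximal AD family. For an AD family $\mathcal{A}$, $\mathcal{I}(\mathcal{A})$ denotes the ideal generated by $\mathcal{A}$ (together with the finite sets), and $\mathcal{I}(\mathcal{A})^+=\wp(\omega)\setminus\mathcal{I}(\mathcal{A})$. A tree $T\subseteq\omega^{<\omega}$ (closed under initial segments) is $\mathcal{X}$-branching, for $\mathcal{X}\subseteq[\omega]^\omega$, if $suc_T(s)=\{n\in\omega: s^\frown\langle n\rangle\in T\}\in\mathcal{X}$ for every $s\in T$. $[T]$ is the set of $f\in\omega^\omega$ with $f\upharpoonright n\in T$ for all $n$, and $im(f)$ is the range of $f$. An AD family $\mathcal{A}$ is $+$-Ramsey if for every $\mathcal{I}(\mathcal{A})^+$-branching tree $T$ there is $f\in[T]$ with $im(f)\in\mathcal{I}(\mathcal{A})^+$. *)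

theory Defs
  imports "HOL-Library.Sublist"
begin

definition almost_disjoint :: "nat set set \<Rightarrow> bool" where
  "almost_disjoint \<A> \<longleftrightarrow>
     (\<forall>A\<in>\<A>. infinite A) \<and> (\<forall>A\<in>\<A>. \<forall>B\<in>\<A>. A \<noteq> B \<longrightarrow> finite (A \<inter> B))"

text \<open>
  The usual convention that MAD families are infinite is not built in here. Finite ones (for
  instance \<open>{UNIV}\<close>) generate the improper ideal and are trivially +-Ramsey, so \<open>infinite \<A>\<close>
  has to be required separately.
\<close>
definition MAD :: "nat set set \<Rightarrow> bool" where
  "MAD \<A> \<longleftrightarrow> almost_disjoint \<A> \<and> (\<forall>\<B>. almost_disjoint \<B> \<and> \<A> \<subseteq> \<B> \<longrightarrow> \<B> = \<A>)"

text \<open>Ideals of sets of naturals; the improper ideal \<open>UNIV\<close> is allowed.\<close>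
definition set_ideal :: "nat set set \<Rightarrow> bool" where
  "set_ideal \<I> \<longleftrightarrow>
     {} \<in> \<I> \<and> (\<forall>X\<in>\<I>. \<forall>Y. Y \<subseteq> X \<longrightarrow> Y \<in> \<I>) \<and> (\<forall>X\<in>\<I>. \<forall>Y\<in>\<I>. X \<union> Y \<in> \<I>)"

definition ideal_of :: "nat set set \<Rightarrow> nat set set" where
  "ideal_of \<A> = \<Inter>{\<I>. set_ideal \<I> \<and> \<A> \<subseteq> \<I> \<and> {X. finite X} \<subseteq> \<I>}"

definition positive_sets :: "nat set set \<Rightarrow> nat set set" where
  "positive_sets \<A> = UNIV - ideal_of \<A>"

text \<open>
  Finite sequences are lists, growing at the end. Trees are nonempty: the empty set would be
  vacuously branching but has no branch.
\<close>
definition seq_tree :: "nat list set \<Rightarrow> bool" where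
  "seq_tree T \<longleftrightarrow> T \<noteq> {} \<and> (\<forall>t\<in>T. \<forall>s. prefix s t \<longrightarrow> s \<in> T)"

definition suc_set :: "nat list set \<Rightarrow> nat list \<Rightarrow> nat set" where
  "suc_set T s = {n. s @ [n] \<in> T}"

definition branching :: "nat set set \<Rightarrow> nat list set \<Rightarrow> bool" where
  "branching \<X> T \<longleftrightarrow> (\<forall>s\<in>T. suc_set T s \<in> \<X>)"

definition branches :: "nat list set \<Rightarrow> (nat \<Rightarrow> nat) set" where
  "branches T = {f. \<forall>n. map f [0..<n] \<in> T}"

definition plus_Ramsey :: "nat set set \<Rightarrow> bool" where
  "plus_Ramsey \<A> \<longleftrightarrow>
     (\<forall>T. seq_tree T \<and> branching (positive_sets \<A>) T \<longrightarrow>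
        (\<exists>f\<in>branches T. range f \<in> positive_sets \<A>))"

lemma ideal_of_iff:
  "X \<in> ideal_of \<A> \<longleftrightarrow> (\<exists>\<F>. finite \<F> \<and> \<F> \<subseteq> \<A> \<and> finite (X - \<Union>\<F>))"
proof
  define J where "J = {X. \<exists>\<F>. finite \<F> \<and> \<F> \<subseteq> \<A> \<and> finite (X - \<Union>\<F>)}"
  have un: "X \<union> Y \<in> J" if "X \<in> J" "Y \<in> J" for X Y
  proof -
    from that obtain F G where "finite F" "F \<subseteq> \<A>" "finite (X - \<Union>F)"
      "finite G" "G \<subseteq> \<A>" "finite (Y - \<Union>G)" unfolding J_def by auto
    moreover have "X \<union> Y - \<Union>(F \<union> G) \<subseteq> (X - \<Union>F) \<union> (Y - \<Union>G)" by auto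
    ultimately have "finite (F \<union> G) \<and> F \<union> G \<subseteq> \<A> \<and> finite (X \<union> Y - \<Union>(F \<union> G))"
      by (meson finite_UnI finite_subset Un_least)
    then show ?thesis unfolding J_def by blast
  qed
  have down: "Y \<in> J" if "X \<in> J" "Y \<subseteq> X" for X Y
    using that unfolding J_def by (auto intro: finite_subset[OF Diff_mono[OF that(2) order_refl]])
  have fin: "X \<in> J" if "finite X" for X
    using that unfolding J_def by (auto intro!: exI[of _ "{}"])
  have gen: "X \<in> J" if "X \<in> \<A>" for X
    using that unfolding J_def by (auto intro!: exI[of _ "{X}"])
  have "set_ideal J"
    unfolding set_ideal_def using un down fin[OF finite.emptyI] by simp
  then have "ideal_of \<A> \<subseteq> J"
    unfolding ideal_of_def using gen fin by (intro Inter_lower) auto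
  then show "\<exists>\<F>. finite \<F> \<and> \<F> \<subseteq> \<A> \<and> finite (X - \<Union>\<F>)" if "X \<in> ideal_of \<A>"
    using that unfolding J_def by blast
next
  assume "\<exists>\<F>. finite \<F> \<and> \<F> \<subseteq> \<A> \<and> finite (X - \<Union>\<F>)"
  then obtain \<F> where F: "finite \<F>" "\<F> \<subseteq> \<A>" "finite (X - \<Union>\<F>)" by blast
  show "X \<in> ideal_of \<A>"
    unfolding ideal_of_def
  proof (intro InterI, clarify)
    fix \<I> assume I: "set_ideal \<I>" "\<A> \<subseteq> \<I>" "{X. finite X} \<subseteq> \<I>"
    have "\<Union>\<F> \<in> \<I>"
      using F(1,2) by (induction rule: finite_induct) (use I in \<open>auto simp: set_ideal_def\<close>)
    then have "\<Union>\<F> \<union> (X - \<Union>\<F>) \<in> \<I>"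
      using I F(3) by (auto simp: set_ideal_def simp del: Un_Diff_cancel)
    then show "X \<in> \<I>"
      using I(1) unfolding set_ideal_def by (metis Un_Diff_cancel Un_upper2)
  qed
qed

lemma positive_sets_infinite: "X \<in> positive_sets \<A> \<Longrightarrow> infinite X"
  by (auto simp: positive_sets_def ideal_of_iff)

end

theory Submission
  imports Defs "HOL-Library.Countable_Set" "HOL-Library.Infinite_Set"
begin

text \<open>
  Let d be the least size of a dominating family. If some infinite MAD family has fewer than d
  members, it is itself +-Ramsey: inside a positively branching tree let the successors of each node
  run through a set from the family, with distinct sets for distinct nodes; the functions bounding
  the finite intersections of these sets with the other members are too few to be dominating, so a
  fast growing branch escapes every finite union of members.

  Otherwise no almost disjoint family of size less than d is maximal below a positive set. A
  dominating family of size d gives sets \<open>S\<^sub>\<beta>\<close>, \<open>\<beta> < d\<close>, such that any countably many infinite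
  sets are split simultaneously by one \<open>S\<^sub>\<beta>\<close>. As in Shelah's construction of completely separable
  MAD families, a family is built by recursion of length continuum, each member being almost decided
  by the \<open>S\<^sub>\<beta>\<close> below some bound and so attached to a node of the tree of binary sequences of length
  less than d. A positive set is split again and again at the least \<open>\<beta>\<close> where both halves stay
  positive; this gives continuum many incompatible nodes, hence unused nodes and new members below
  the set. Trees are treated in the same way: a tree decides \<open>S\<^sub>\<beta>\<close> if all its branches eventually
  stay in one side, up to ideal sets attached to the nodes, and if it does not, then some positive
  subtree lies in the other side. So trees can be split like sets, and counting finds a branch whose
  range is positive.
\<close>

unbundle cardinal_syntax

section \<open>Ideals generated by almost disjoint families\<close>

lemma ideal_of_subset: "X \<in> ideal_of \<A> \<Longrightarrow> Y \<subseteq> X \<Longrightarrow> Y \<in> ideal_of \<A>"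
  unfolding ideal_of_iff by (meson Diff_mono finite_subset order_refl)

lemma ideal_of_Un: "X \<in> ideal_of \<A> \<Longrightarrow> Y \<in> ideal_of \<A> \<Longrightarrow> X \<union> Y \<in> ideal_of \<A>"
  by (simp add: ideal_of_def set_ideal_def)

lemma ideal_of_finite: "finite X \<Longrightarrow> X \<in> ideal_of \<A>"
  unfolding ideal_of_def by blast

lemma ideal_of_mono: "\<A> \<subseteq> \<B> \<Longrightarrow> ideal_of \<A> \<subseteq> ideal_of \<B>"
  unfolding ideal_of_def by blast

lemma ideal_of_UN: "finite S \<Longrightarrow> (\<And>s. s \<in> S \<Longrightarrow> X s \<in> ideal_of \<A>) \<Longrightarrow> (\<Union>s\<in>S. X s) \<in> ideal_of \<A>"
  by (induction S rule: finite_induct) (auto intro: ideal_of_Un ideal_of_finite)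

lemma finite_Int_ideal_of:
  assumes "X \<in> ideal_of \<A>" "\<And>A. A \<in> \<A> \<Longrightarrow> finite (Z \<inter> A)"
  shows "finite (X \<inter> Z)"
proof -
  obtain F where F: "finite F" "F \<subseteq> \<A>" "finite (X - \<Union>F)"
    using assms(1) unfolding ideal_of_iff by blast
  have "finite (\<Union>B\<in>F. Z \<inter> B)" using F assms(2) by (intro finite_UN_I) auto
  then have "finite ((X - \<Union>F) \<union> (\<Union>B\<in>F. Z \<inter> B))" using F(3) by simp
  then show ?thesis by (rule rev_finite_subset) blast
qed

lemma not_ideal_of_infinite: "X \<notin> ideal_of \<A> \<Longrightarrow> infinite X"
  using ideal_of_finite by blast

text \<open>If finitely many members almost covered \<open>X\<close>, some further member would
  still meet \<open>X\<close> infinitely, while its intersections with the covering members are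
  finite.\<close>

lemma not_ideal_of_if_infinitely_many:
  assumes ad: "almost_disjoint \<A>" and inf: "infinite {A \<in> \<A>. infinite (A \<inter> X)}"
  shows "X \<notin> ideal_of \<A>"
proof
  assume "X \<in> ideal_of \<A>"
  then obtain F where F: "finite F" "F \<subseteq> \<A>" "finite (X - \<Union>F)"
    unfolding ideal_of_iff by blast
  have "infinite ({A \<in> \<A>. infinite (A \<inter> X)} - F)" using inf F(1) by simp
  then obtain A where A: "A \<in> \<A>" "infinite (A \<inter> X)" "A \<notin> F"
    using infinite_imp_nonempty by blast
  have "A \<inter> X \<subseteq> (X - \<Union>F) \<union> (\<Union>B\<in>F. A \<inter> B)" by blast
  moreover have "finite (\<Union>B\<in>F. A \<inter> B)"
  proof (rule finite_UN_I[OF F(1)])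
    fix B assume "B \<in> F"
    then have "B \<in> \<A>" "B \<noteq> A" using F(2) A(3) by auto
    then show "finite (A \<inter> B)" using ad A(1) unfolding almost_disjoint_def by metis
  qed
  ultimately show False using A(2) F(3) finite_subset[of "A \<inter> X"] by blast
qed

lemma not_ideal_of_if_almost_disjoint:
  assumes "infinite Y" "Y \<subseteq> X" "\<And>A. A \<in> \<A> \<Longrightarrow> finite (Y \<inter> A)"
  shows "X \<notin> ideal_of \<A>"
  using finite_Int_ideal_of[of X \<A> Y] assms by (auto simp: inf_absorb2)

lemma infinite_Diff_if_finitely_many:
  assumes "X \<notin> ideal_of \<A>" "finite F" "F \<subseteq> \<A>"
  shows "infinite (X - \<Union>F)"
  using assms by (metis ideal_of_iff)

text \<open>At stage \<open>m\<close> an element above \<open>m\<close> is taken from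
  \<open>X m\<close> and from \<open>B k\<close>, where \<open>k\<close> is the first coordinate of
  \<open>prod_decode m\<close>. Every \<open>k\<close> recurs infinitely often, so all the
  \<open>B k\<close> are served.\<close>

lemma pseudo_intersection:
  fixes X B :: "nat \<Rightarrow> nat set"
  assumes dec: "antimono X" and inf: "\<forall>k n. infinite (B k \<inter> X n)"
  obtains Y where "Y \<subseteq> X 0" "\<And>n. finite (Y - X n)" "\<And>k. infinite (B k \<inter> Y)"
proof -
  have "\<exists>y. y \<in> B (fst (prod_decode m)) \<inter> X m \<and> m < y" for m
    using inf[rule_format, of "fst (prod_decode m)" m] unfolding infinite_nat_iff_unbounded by blast
  then obtain y where y: "\<And>m. y m \<in> B (fst (prod_decode m)) \<inter> X m \<and> m < y m" by metis
  have "range y \<subseteq> X 0" using y antimonoD[OF dec le0] by (meson IntD2 image_subsetI subsetD)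
  moreover have "finite (range y - X n)" for n
  proof (rule finite_subset)
    show "range y - X n \<subseteq> y ` {..<n}"
    proof (rule ccontr)
      assume "\<not> ?thesis"
      then obtain m where "y m \<notin> X n" "y m \<notin> y ` {..<n}" by blast
      then have "n \<le> m" by (meson imageI lessThan_iff not_le)
      then have "X m \<subseteq> X n" by (rule antimonoD[OF dec])
      then show False using y[of m] \<open>y m \<notin> X n\<close> by (meson IntD2 subsetD)
    qed
  qed simp
  moreover have "infinite (B k \<inter> range y)" for k
    unfolding infinite_nat_iff_unbounded
  proof
    fix m
    have "y (prod_encode (k, m)) \<in> B k" "prod_encode (k, m) < y (prod_encode (k, m))"
      using y[of "prod_encode (k, m)"] by auto
    moreover have "m \<le> prod_encode (k, m)" by (rule le_prod_encode_2)
    ultimately show "\<exists>n>m. n \<in> B k \<inter> range y"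
      by (intro exI[of _ "y (prod_encode (k, m))"]) auto
  qed
  ultimately show ?thesis by (rule that)
qed

text \<open>Let \<open>C\<close> be the set of members that meet every \<open>X n\<close>
  infinitely. If \<open>C\<close> is finite, a pseudo-intersection can be taken outside its union;
  every other member has finite trace on some \<open>X n\<close>, hence on the pseudo-intersection.
  If \<open>C\<close> is infinite, a pseudo-intersection meeting countably many of its elements
  infinitely is positive.\<close>

lemma positive_pseudo_intersection:
  fixes X :: "nat \<Rightarrow> nat set"
  assumes ad: "almost_disjoint \<A>" and dec: "antimono X"
    and pos: "\<And>n. X n \<notin> ideal_of \<A>"
  obtains Y where "Y \<subseteq> X 0" "\<And>n. finite (Y - X n)" "Y \<notin> ideal_of \<A>"
proof -
  define C where "C = {A \<in> \<A>. \<forall>n. infinite (A \<inter> X n)}"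
  show ?thesis
  proof (cases "finite C")
    case True
    have "\<forall>k::nat. \<forall>n. infinite (- \<Union>C \<inter> X n)"
      using infinite_Diff_if_finitely_many[OF pos True] unfolding C_def
      by (simp add: Diff_eq Int_commute)
    from pseudo_intersection[OF dec this] obtain Y where
      Y: "Y \<subseteq> X 0" "\<And>n. finite (Y - X n)" "infinite (- \<Union>C \<inter> Y)" by metis
    have "finite (- \<Union>C \<inter> Y \<inter> A)" if "A \<in> \<A>" for A
    proof (cases "A \<in> C")
      case True
      then have "- \<Union>C \<inter> Y \<inter> A = {}" by blast
      then show ?thesis by simp
    next
      case False
      then obtain n where "finite (A \<inter> X n)" using \<open>A \<in> \<A>\<close> unfolding C_def by blast
      then have "finite ((A \<inter> X n) \<union> (Y - X n))" using Y(2) by blast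
      then show ?thesis by (rule rev_finite_subset) blast
    qed
    from not_ideal_of_if_almost_disjoint[OF Y(3) _ this] have "Y \<notin> ideal_of \<A>" by blast
    with Y(1,2) show ?thesis by (rule that)
  next
    case False
    then obtain B :: "nat \<Rightarrow> nat set" where B: "inj B" "range B \<subseteq> C"
      using infinite_countable_subset by blast
    have "\<forall>k n. infinite (B k \<inter> X n)" using B(2) unfolding C_def by blast
    from pseudo_intersection[OF dec this] obtain Y where
      Y: "Y \<subseteq> X 0" "\<And>n. finite (Y - X n)" "\<And>k. infinite (B k \<inter> Y)" by metis
    have "range B \<subseteq> {A \<in> \<A>. infinite (A \<inter> Y)}" using B(2) Y(3) unfolding C_def by blast
    then have "infinite {A \<in> \<A>. infinite (A \<inter> Y)}"
      using B(1) finite_subset range_inj_infinite by blast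
    then have "Y \<notin> ideal_of \<A>" by (rule not_ideal_of_if_infinitely_many[OF ad])
    with Y(1,2) show ?thesis by (rule that)
  qed
qed

text \<open>Otherwise removing the finitely many relevant members from \<open>X\<close> leaves an
  infinite set almost disjoint from the whole family, against maximality.\<close>

lemma MAD_infinitely_many:
  assumes mad: "MAD \<A>" and pos: "X \<notin> ideal_of \<A>"
  shows "infinite {A \<in> \<A>. infinite (A \<inter> X)}"
proof
  assume fin: "finite {A \<in> \<A>. infinite (A \<inter> X)}" (is "finite ?F")
  define Y where "Y = X - \<Union>?F"
  have Y: "infinite Y" unfolding Y_def using infinite_Diff_if_finitely_many[OF pos fin] by blast
  have Yad: "finite (Y \<inter> A)" if "A \<in> \<A>" for A
  proof (cases "A \<in> ?F")
    case True
    then have "Y \<inter> A = {}" unfolding Y_def by blast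
    then show ?thesis by simp
  next
    case False
    then have "finite (A \<inter> X)" using that by blast
    then show ?thesis by (rule rev_finite_subset) (auto simp: Y_def)
  qed
  have "almost_disjoint (insert Y \<A>)"
    using mad Y Yad unfolding MAD_def almost_disjoint_def by (auto simp: Int_commute)
  then have "Y \<in> \<A>" using mad unfolding MAD_def by blast
  then show False using Yad Y by force
qed

section \<open>Paths through schemes\<close>

text \<open>The numbers come from the selector \<open>v\<close>, the bits from a free string
  \<open>x\<close>. A single selector thus serves all strings, and strings with a common initial
  part share the corresponding part of their paths.\<close>

primrec path :: "((nat \<times> bool) list \<Rightarrow> nat) \<Rightarrow> (nat \<Rightarrow> bool) \<Rightarrow> nat \<Rightarrow> (nat \<times> bool) list" where
  "path v x 0 = []"
| "path v x (Suc k) = path v x k @ [(v (path v x k), x k)]"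

lemma length_path [simp]: "length (path v x k) = k"
  by (induction k) auto

lemma path_cong: "(\<And>i. i < k \<Longrightarrow> x i = x' i) \<Longrightarrow> path v x k = path v x' k"
  by (induction k) auto

lemma prefix_nth: "prefix xs ys \<Longrightarrow> i < length xs \<Longrightarrow> ys ! i = xs ! i"
  by (auto simp: prefix_def nth_append)

lemma scheme_prefix:
  assumes step: "\<forall>l. \<forall>n\<in>Z l. \<forall>b. prefix (U l @ [n]) (U (l @ [(n, b)]))"
    and v: "\<forall>l. v l \<in> Z l"
  shows scheme_prefix_Suc: "prefix (U (path v x k) @ [v (path v x k)]) (U (path v x (Suc k)))"
    and scheme_prefix_mono: "i \<le> k \<Longrightarrow> prefix (U (path v x i)) (U (path v x k))"
    and scheme_length: "k \<le> length (U (path v x k))"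
    and scheme_inj: "inj (\<lambda>k. U (path v x k))"
proof -
  show *: "prefix (U (path v x k) @ [v (path v x k)]) (U (path v x (Suc k)))" for k
    using step v by simp
  show "prefix (U (path v x i)) (U (path v x k))" if "i \<le> k" for i k
    using that
  proof (induction k rule: dec_induct)
    case (step n)
    then show ?case using *[of n] by (meson append_prefixD prefix_order.trans)
  qed simp
  have len: "length (U (path v x k)) < length (U (path v x (Suc k)))" for k
    using prefix_length_le[OF *[of k]] by simp
  show "k \<le> length (U (path v x k))"
  proof (induction k)
    case (Suc k)
    then show ?case using len[of k] by linarith
  qed simp
  have "strict_mono (\<lambda>k. length (U (path v x k)))"
    using len by (simp add: strict_mono_Suc_iff)
  then have "inj (\<lambda>k. length (U (path v x k)))" by (rule strict_mono_imp_inj_on)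
  then show "inj (\<lambda>k. U (path v x k))" unfolding inj_def by metis
qed

lemma scheme_branch:
  assumes T: "seq_tree T" and U: "\<forall>l. U l \<in> T"
    and step: "\<forall>l. \<forall>n\<in>Z l. \<forall>b. prefix (U l @ [n]) (U (l @ [(n, b)]))"
    and v: "\<forall>l. v l \<in> Z l"
  obtains f where "f \<in> branches T"
    "\<forall>k. map f [0..<length (U (path v x k))] = U (path v x k)"
    "\<forall>k. f (length (U (path v x k))) = v (path v x k)"
proof -
  note sp = scheme_prefix[where U = U and Z = Z and v = v, OF step v]
  \<comment> \<open>Stage \<open>Suc n\<close> is late enough, since its node has length at least
    \<open>Suc n\<close>.\<close>
  define f where "f n = U (path v x (Suc n)) ! n" for n
  have f: "f n = U (path v x k) ! n" if "n < length (U (path v x k))" for n k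
  proof (cases "Suc n \<le> k")
    case True
    then show ?thesis using prefix_nth[OF sp(2)[OF True]] sp(3)[of "Suc n" x] unfolding f_def by force
  next
    case False
    then show ?thesis using prefix_nth[OF sp(2)[of k "Suc n" x]] that unfolding f_def by force
  qed
  have map_f: "map f [0..<n] = take n (U (path v x k))" if "n \<le> length (U (path v x k))" for n k
    using that f[of _ k] by (intro nth_equalityI) auto
  have "map f [0..<n] \<in> T" for n
    using map_f[OF sp(3)] T U take_is_prefix unfolding seq_tree_def by metis
  then have "f \<in> branches T" unfolding branches_def by blast
  moreover have "f (length (U (path v x k))) = v (path v x k)" for k
  proof -
    let ?m = "length (U (path v x k))"
    have "?m < length (U (path v x (Suc k)))"
      using prefix_length_le[OF sp(1)[of x k]] by simp
    then have "f ?m = U (path v x (Suc k)) ! ?m" by (rule f)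
    also have "\<dots> = v (path v x k)" using prefix_nth[OF sp(1)[of x k], of ?m] by simp
    finally show ?thesis .
  qed
  ultimately show ?thesis using that[of f] map_f[OF order_refl] by simp
qed

lemma infinite_of_INFM_unbounded:
  assumes "\<exists>\<^sub>\<infinity>k. w k \<in> R" "\<And>k. k < (w k :: nat)"
  shows "infinite R"
  unfolding infinite_nat_iff_unbounded
proof
  fix m
  obtain k where "m < k" "w k \<in> R" using assms(1) unfolding INFM_nat by blast
  then show "\<exists>n>m. n \<in> R" using assms(2)[of k] by (meson less_trans)
qed

section \<open>Sets smaller than an uncountable index set\<close>

lemma card_of_lists_le:
  fixes J :: "'a set"
  assumes r: "Cinfinite r" and J: "|J| \<le>o r"
  shows "|lists J| \<le>o r"
proof -
  have "|{l \<in> lists J. length l = n}| \<le>o r" for n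
  proof (induction n)
    case 0
    have "{l \<in> lists J. length l = 0} = {[]}" by auto
    moreover have "|{[] :: 'a list}| \<le>o r"
      using r Cfinite_ordLess_Cinfinite[of "|{[] :: 'a list}|" r]
      by (simp add: cfinite_def ordLess_imp_ordLeq Field_card_of card_of_card_order_on)
    ultimately show ?case by simp
  next
    case (Suc n)
    have "{l \<in> lists J. length l = Suc n} \<subseteq> (\<lambda>(x, l). x # l) ` (J \<times> {l \<in> lists J. length l = n})"
      by (auto simp: length_Suc_conv image_iff)
    then have "|{l \<in> lists J. length l = Suc n}| \<le>o |J \<times> {l \<in> lists J. length l = n}|"
      by (meson card_of_image card_of_mono1 ordLeq_transitive)
    moreover have "|J \<times> {l \<in> lists J. length l = n}| \<le>o r"
      using r J Suc by (intro card_of_Times_ordLeq_infinite_Field) (auto simp: cinfinite_def)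
    ultimately show ?case by (rule ordLeq_transitive)
  qed
  moreover have "lists J = (\<Union>n. {l \<in> lists J. length l = n})" by auto
  moreover have "|UNIV :: nat set| \<le>o r"
    using r natLeq_ordLeq_cinfinite card_of_nat ordIso_ordLeq_trans by blast
  ultimately show ?thesis
    using UNION_Cinfinite_bound[OF _ _ r, of UNIV "\<lambda>n. {l \<in> lists J. length l = n}"] by simp
qed

locale uncountable_index =
  fixes D :: "'k set"
  assumes uncountable_D: "|UNIV :: nat set| <o |D|"
begin

definition small :: "'x set \<Rightarrow> bool" where
  "small J \<longleftrightarrow> |J| <o |D|"

lemma infinite_D: "infinite D"
  using uncountable_D by (metis card_of_ordLeq_infinite infinite_UNIV_nat ordLess_imp_ordLeq)

lemma small_le: "small B \<Longrightarrow> |A| \<le>o |B| \<Longrightarrow> small A"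
  unfolding small_def using ordLeq_ordLess_trans by blast

lemma small_subset: "small B \<Longrightarrow> A \<subseteq> B \<Longrightarrow> small A"
  using small_le card_of_mono1 by blast

lemma small_image: "small A \<Longrightarrow> small (f ` A)"
  using small_le card_of_image by blast

lemma small_countable: "countable A \<Longrightarrow> small A"
  using uncountable_D unfolding small_def
  by (metis countable_def card_of_ordLeq ordLeq_ordLess_trans subset_UNIV)

lemma small_Un: "small A \<Longrightarrow> small B \<Longrightarrow> small (A \<union> B)"
  unfolding small_def using card_of_Un_ordLess_infinite[OF infinite_D] by blast

lemma small_imp_Cinfinite:
  fixes A :: "'a set" and B :: "'b set"
  assumes "small A" "small B"
  obtains C :: "('a + 'b + nat) set" where "small C" "Cinfinite |C|" "|A| \<le>o |C|" "|B| \<le>o |C|"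
proof
  let ?C = "A <+> B <+> (UNIV :: nat set)"
  have "|B <+> (UNIV :: nat set)| <o |D|"
    using assms uncountable_D infinite_D unfolding small_def
    by (intro card_of_Plus_ordLess_infinite) auto
  then show "small ?C"
    using assms infinite_D unfolding small_def by (intro card_of_Plus_ordLess_infinite[of D A])
  have "infinite ?C" by (simp add: finite_Plus_iff)
  then show "Cinfinite |?C|" by (simp add: cinfinite_def Field_card_of card_of_card_order_on)
  show "|A| \<le>o |?C|" by (rule card_of_Plus1)
  have "|B| \<le>o |B <+> (UNIV :: nat set)|" by (rule card_of_Plus1)
  then show "|B| \<le>o |?C|" using card_of_Plus2 ordLeq_transitive by blast
qed

lemma small_UN:
  fixes I :: "'a set" and B :: "'b set"
  assumes "small I" "small B" "\<And>i. i \<in> I \<Longrightarrow> |F i| \<le>o |B|"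
  shows "small (\<Union>i\<in>I. F i)"
proof -
  obtain C :: "('a + 'b + nat) set" where C: "small C" "Cinfinite |C|" "|I| \<le>o |C|" "|B| \<le>o |C|"
    using small_imp_Cinfinite[OF assms(1,2)] .
  have "|\<Union>i\<in>I. F i| \<le>o |C|"
    using assms(3) C(3,4) ordLeq_transitive by (intro UNION_Cinfinite_bound[OF _ _ C(2)]) blast+
  then show ?thesis using C(1) small_le by blast
qed

lemma small_UN_countable:
  assumes "small I" "\<And>i. i \<in> I \<Longrightarrow> countable (F i)"
  shows "small (\<Union>i\<in>I. F i)"
proof (rule small_UN[OF assms(1)])
  show "small (UNIV :: nat set)" by (rule small_countable) simp
  show "|F i| \<le>o |UNIV :: nat set|" if "i \<in> I" for i
    using assms(2)[OF that] unfolding countable_def by (meson card_of_ordLeq subset_UNIV)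
qed

lemma small_lists:
  fixes J :: "'a set"
  assumes "small J"
  shows "small (lists J)"
proof -
  obtain C :: "('a + 'a + nat) set" where C: "small C" "Cinfinite |C|" "|J| \<le>o |C|"
    using small_imp_Cinfinite[OF assms assms] .
  then show ?thesis using card_of_lists_le[OF C(2,3)] small_le by blast
qed

end

section \<open>Families too small to dominate\<close>

locale nondominated = uncountable_index D for D :: "'k set" +
  assumes nondominated: "|H| <o |D| \<Longrightarrow> \<exists>g :: nat \<Rightarrow> nat. \<forall>h\<in>H. \<exists>\<^sub>\<infinity>n. h n < g n"
begin

lemma scheme_selector:
  fixes J :: "'j set" and H :: "'j \<Rightarrow> (nat \<times> bool) list \<Rightarrow> nat"
  assumes J: "small J" and Z: "\<forall>l. infinite (Z l)"
  obtains v where "\<forall>l. v l \<in> Z l" "\<forall>l. length l < v l"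
    "\<forall>x K. finite K \<and> K \<subseteq> J \<longrightarrow> (\<exists>\<^sub>\<infinity>k. \<forall>j\<in>K. H j (path v x k) < v (path v x k))"
proof -
  define h where "h Ks l = Max (insert 0 ((\<lambda>j. H j l) ` set Ks))" for Ks l
  \<comment> \<open>Level \<open>i\<close> of the finitely branching tree above \<open>l0\<close>:
    each appended number is at most the value of \<open>h Ks\<close> at the list before it.\<close>
  define L where "L Ks l0 = rec_nat {l0}
    (\<lambda>_ M. \<Union>l\<in>M. (\<lambda>c. l @ [c]) ` ({..h Ks l} \<times> UNIV))" for Ks l0
  have L0: "L Ks l0 0 = {l0}"
    and LS: "L Ks l0 (Suc i) = (\<Union>l\<in>L Ks l0 i. (\<lambda>c. l @ [c]) ` ({..h Ks l} \<times> UNIV))" for Ks l0 i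
    unfolding L_def by simp_all
  have finL: "finite (L Ks l0 i)" for Ks l0 i
    by (induction i) (auto simp: L0 LS)
  define m where "m = (\<lambda>(Ks, l0) k. Max (h Ks ` L Ks l0 (k - length l0)))"
  have "small (\<Union>Ks\<in>lists J. (\<lambda>l0. (Ks, l0)) ` (UNIV :: (nat \<times> bool) list set))"
    by (rule small_UN_countable[OF small_lists[OF J]]) simp
  then have "small (m ` (lists J \<times> UNIV))"
    by (intro small_image) (erule small_subset, auto)
  from nondominated[OF this[unfolded small_def]] obtain g where
    g: "\<And>Ks l0. Ks \<in> lists J \<Longrightarrow> \<exists>\<^sub>\<infinity>n. m (Ks, l0) n < g n" by blast
  define v where "v l = (SOME n. n \<in> Z l \<and> g (length l) + length l < n)" for l
  have "v l \<in> Z l \<and> g (length l) + length l < v l" for l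
    unfolding v_def by (rule someI_ex) (use Z in \<open>auto simp: infinite_nat_iff_unbounded\<close>)
  then have v: "v l \<in> Z l" "g (length l) < v l" "length l < v l" for l
    by (simp, metis add_lessD1, metis add_lessD1 add.commute)
  have "\<exists>\<^sub>\<infinity>k. \<forall>j\<in>K. H j (path v x k) < v (path v x k)" if K: "finite K" "K \<subseteq> J" for x K
  proof (rule ccontr)
    assume "\<not> ?thesis"
    then obtain k0 where k0: "\<And>k. k0 \<le> k \<Longrightarrow> \<exists>j\<in>K. v (path v x k) \<le> H j (path v x k)"
      unfolding INFM_nat_le by (auto simp: not_less)
    obtain Ks where Ks: "set Ks = K" using K(1) finite_list by blast
    let ?l0 = "path v x k0"
    have le: "v (path v x k) \<le> h Ks (path v x k)" if "k0 \<le> k" for k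
    proof -
      obtain j where "j \<in> K" "v (path v x k) \<le> H j (path v x k)" using k0 \<open>k0 \<le> k\<close> by blast
      moreover have "H j (path v x k) \<le> h Ks (path v x k)"
        unfolding h_def Ks using \<open>j \<in> K\<close> K(1) by (intro Max_ge) auto
      ultimately show ?thesis by simp
    qed
    have mem: "path v x (k0 + i) \<in> L Ks ?l0 i" for i
    proof (induction i)
      case (Suc i)
      show ?case
        unfolding LS by (rule UN_I[OF Suc]) (use le[of "k0 + i"] in auto)
    qed (simp add: L0)
    have "g k < m (Ks, ?l0) k" if "k0 \<le> k" for k
    proof -
      have "g k < v (path v x k)" using v(2)[of "path v x k"] by simp
      also have "\<dots> \<le> h Ks (path v x k)" by (rule le[OF that])
      also have "\<dots> \<le> m (Ks, ?l0) k"
        using mem[of "k - k0"] that finL unfolding m_def by (auto intro!: Max_ge)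
      finally show ?thesis .
    qed
    moreover have "Ks \<in> lists J" using Ks K(2) by auto
    ultimately show False using g[of Ks ?l0] unfolding INFM_nat_le by (meson less_asym)
  qed
  then show ?thesis using that[of v] v(1,3) by blast
qed

end

section \<open>The case of an infinite MAD family smaller than the index set\<close>

lemma inj_choice_nat:
  assumes "\<And>n :: nat. infinite (C n)"
  obtains c where "inj c" "\<And>n. c n \<in> C n"
proof -
  have "\<exists>c. \<forall>n. c n \<in> C n - c ` {..<n}"
  proof (rule dependent_wf_choice[OF wf_less_than])
    show "(r \<in> C n - f ` {..<n}) = (r \<in> C n - g ` {..<n})"
      if "\<And>z. (z, n) \<in> less_than \<Longrightarrow> f z = g z" for f g n and r
      using that by (metis image_cong lessThan_iff less_than_iff)
    show "\<exists>r. r \<in> C n - f ` {..<n}" for n and f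
      using assms[of n] by (metis Diff_infinite_finite finite_imageI finite_lessThan ex_in_conv finite.emptyI)
  qed
  then obtain c where c: "\<And>n. c n \<in> C n - c ` {..<n}" by blast
  have "inj c"
  proof (rule linorder_injI)
    show "c m \<noteq> c n" if "m < n" for m n using c[of n] that by (metis DiffD2 imageI lessThan_iff)
  qed
  then show ?thesis using that c by blast
qed

lemma inj_choice_countable:
  assumes "\<And>s :: 's :: countable. infinite (C s)"
  obtains c where "inj c" "\<And>s. c s \<in> C s"
proof -
  obtain d where d: "inj d" "\<And>n. d n \<in> C (from_nat n)"
    using inj_choice_nat[of "\<lambda>n. C (from_nat n)"] assms by blast
  have "inj (d \<circ> to_nat)" using d(1) by (intro inj_compose) auto
  moreover have "(d \<circ> to_nat) s \<in> C s" for s using d(2)[of "to_nat s"] by simp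
  ultimately show ?thesis by (rule that)
qed

context nondominated
begin

theorem small_MAD_plus_Ramsey:
  assumes mad: "MAD \<A>" and inf: "infinite \<A>" and small: "small \<A>"
  shows "plus_Ramsey \<A>"
  unfolding plus_Ramsey_def
proof clarify
  fix T assume T: "seq_tree T" and br: "branching (positive_sets \<A>) T"
  have ad: "almost_disjoint \<A>" using mad unfolding MAD_def by blast
  \<comment> \<open>Off the tree the value is all of \<open>\<A>\<close>, which keeps
    \<open>C s\<close> infinite for every list, as the injective choice requires.\<close>
  define C where "C s = (if s \<in> T then {A \<in> \<A>. infinite (A \<inter> suc_set T s)} else \<A>)" for s
  have "infinite (C s)" for s
    using MAD_infinitely_many[OF mad] br inf
    unfolding C_def branching_def positive_sets_def by auto
  then obtain c where c: "inj c" "\<And>s. c s \<in> C s" using inj_choice_countable[of C] by blast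
  have cA: "c s \<in> \<A>" for s using c(2)[of s] unfolding C_def by (auto split: if_splits)
  define Z0 where "Z0 s = c s \<inter> suc_set T s" for s
  define U where "U l = foldl (\<lambda>s (n, b). if n \<in> Z0 s then s @ [n] else s) [] l"
    for l :: "(nat \<times> bool) list"
  define Z where "Z l = Z0 (U l)" for l
  have nil: "[] \<in> T" using T unfolding seq_tree_def by (metis Nil_prefix ex_in_conv)
  have U: "U l \<in> T" for l
    by (induction l rule: rev_induct) (auto simp: U_def nil Z0_def suc_set_def)
  have step: "\<forall>l. \<forall>n\<in>Z l. \<forall>b. prefix (U l @ [n]) (U (l @ [(n, b)]))"
    by (auto simp: U_def Z_def)
  have "infinite (Z l)" for l
    using c(2)[of "U l"] U[of l] unfolding Z_def Z0_def C_def by simp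
  then have infZ: "\<forall>l. infinite (Z l)" by simp
  \<comment> \<open>The maximum is meaningful when \<open>A\<close> differs from the member attached
    to the node: then \<open>A\<close> has finite trace on \<open>Z l\<close>, and a number beyond
    the maximum avoids \<open>A\<close>.\<close>
  obtain v where v: "\<forall>l. v l \<in> Z l" "\<forall>l. length l < v l"
    "\<forall>x K. finite K \<and> K \<subseteq> \<A> \<longrightarrow>
      (\<exists>\<^sub>\<infinity>k. \<forall>A\<in>K. Max (A \<inter> Z (path v x k)) < v (path v x k))"
    using scheme_selector[OF small infZ, of "\<lambda>A l. Max (A \<inter> Z l)"] by blast
  define p where "p = path v (\<lambda>_. True)"
  have injU: "inj (\<lambda>k. U (p k))" unfolding p_def using scheme_prefix(4)[OF step v(1)] .
  obtain f where f: "f \<in> branches T" "\<forall>k. f (length (U (p k))) = v (p k)"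
    unfolding p_def using scheme_branch[OF T _ step v(1), of "\<lambda>_. True"] U by metis
  have "range f \<notin> ideal_of \<A>"
  proof
    assume "range f \<in> ideal_of \<A>"
    then obtain K where K: "finite K" "K \<subseteq> \<A>" "finite (range f - \<Union>K)"
      unfolding ideal_of_iff by blast
    \<comment> \<open>Distinct nodes carry distinct members, so only finitely many stages pick
      inside a member of \<open>K\<close>.\<close>
    have "finite ((\<lambda>k. c (U (p k))) -` K)"
      using K(1) inj_compose[OF c(1) injU] by (intro finite_vimageI) (simp_all add: comp_def)
    then have "\<forall>\<^sub>\<infinity>k. c (U (p k)) \<notin> K" by (simp add: eventually_cofinite vimage_def)
    moreover have "\<exists>\<^sub>\<infinity>k. \<forall>A\<in>K. Max (A \<inter> Z (p k)) < v (p k)"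
      unfolding p_def using v(3) K(1,2) by blast
    ultimately have "\<exists>\<^sub>\<infinity>k. (\<forall>A\<in>K. Max (A \<inter> Z (p k)) < v (p k)) \<and> c (U (p k)) \<notin> K"
      by (elim frequently_rev_mp eventually_mono) simp
    then have "\<exists>\<^sub>\<infinity>k. v (p k) \<in> range f - \<Union>K"
    proof (rule INFM_mono)
      fix k assume k: "(\<forall>A\<in>K. Max (A \<inter> Z (p k)) < v (p k)) \<and> c (U (p k)) \<notin> K"
      have "v (p k) \<notin> A" if "A \<in> K" for A
      proof
        assume "v (p k) \<in> A"
        have "A \<noteq> c (U (p k))" "A \<in> \<A>" using k that K(2) by auto
        then have "finite (A \<inter> c (U (p k)))" using ad cA unfolding almost_disjoint_def by metis
        then have "finite (A \<inter> Z (p k))" by (rule rev_finite_subset) (auto simp: Z_def Z0_def)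
        then have "v (p k) \<le> Max (A \<inter> Z (p k))" using \<open>v (p k) \<in> A\<close> v(1) by (intro Max_ge) auto
        then show False using k that by (meson not_less)
      qed
      then show "v (p k) \<in> range f - \<Union>K" using f(2) by (metis DiffI UnionE rangeI)
    qed
    moreover have "k < v (p k)" for k using v(2)[rule_format, of "p k"] unfolding p_def by simp
    ultimately show False using infinite_of_INFM_unbounded K(3) by metis
  qed
  then show "\<exists>f\<in>branches T. range f \<in> positive_sets \<A>"
    using f(1) unfolding positive_sets_def by blast
qed

end

section \<open>Nodes of the binary tree of height d\<close>

text \<open>The second case in abstract form: \<open>D\<close> is well-ordered by the relation with
  small initial segments and no countable cofinal subset, the sets \<open>S a\<close> split
  countably many infinite sets at once, and infinite MAD families are not small.\<close>

locale splitting_index = nondominated D for D :: "'k set" +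
  fixes lt :: "'k \<Rightarrow> 'k \<Rightarrow> bool" (infix "\<sqsubset>" 50) and S :: "'k \<Rightarrow> nat set"
  assumes lt_least: "a \<in> D \<Longrightarrow> P a \<Longrightarrow> \<exists>m\<in>D. P m \<and> (\<forall>b\<in>D. b \<sqsubset> m \<longrightarrow> \<not> P b)"
    and lt_trans: "a \<sqsubset> b \<Longrightarrow> b \<sqsubset> c \<Longrightarrow> a \<sqsubset> c"
    and lt_total: "a \<in> D \<Longrightarrow> b \<in> D \<Longrightarrow> a \<sqsubset> b \<or> a = b \<or> b \<sqsubset> a"
    and countable_bounded: "countable C \<Longrightarrow> C \<subseteq> D \<Longrightarrow> \<exists>a\<in>D. \<forall>c\<in>C. c \<sqsubset> a"
    and small_below: "a \<in> D \<Longrightarrow> small {b \<in> D. b \<sqsubset> a}"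
    and splitting: "(\<And>n :: nat. infinite (X n)) \<Longrightarrow>
      \<exists>a\<in>D. \<forall>n. infinite (X n \<inter> S a) \<and> infinite (X n - S a)"
    and no_small_MAD: "MAD \<A> \<Longrightarrow> infinite \<A> \<Longrightarrow> \<not> small \<A>"
begin

definition side :: "'k \<Rightarrow> bool \<Rightarrow> nat set" where
  "side a i = (if i then S a else - S a)"

lemma side_Not: "side a (\<not> i) = - side a i"
  by (simp add: side_def)

text \<open>The enumeration of \<open>Y\<close> transports the infinite traces of
  \<open>\<B>\<close> on \<open>Y\<close> to an almost disjoint family on the naturals. If it is
  finite, subtracting finitely many members suffices. If it is infinite, it is too small to be
  maximal, and a set that can be added to it is carried back into \<open>Y\<close>.\<close>

lemma almost_disjoint_from_small:
  assumes ad: "almost_disjoint \<A>" and Y: "Y \<notin> ideal_of \<A>" and \<B>: "\<B> \<subseteq> \<A>" "small \<B>"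
  obtains Z where "Z \<subseteq> Y" "infinite Z" "\<And>B. B \<in> \<B> \<Longrightarrow> finite (Z \<inter> B)"
proof -
  have infY: "infinite Y" using Y by (rule not_ideal_of_infinite)
  define e where "e = enumerate Y"
  have e: "inj e" "range e = Y"
    using bij_enumerate[OF infY] unfolding e_def bij_betw_def by auto
  define \<B>' where "\<B>' = {B \<in> \<B>. infinite (B \<inter> Y)}"
  have eB: "e ` (e -` B) = B \<inter> Y" for B using e(2) by auto
  show ?thesis
  proof (cases "finite ((\<lambda>B. e -` B) ` \<B>')")
    case True
    then obtain F where F: "F \<subseteq> \<B>'" "finite F" "(\<lambda>B. e -` B) ` \<B>' = (\<lambda>B. e -` B) ` F"
      by (metis finite_subset_image order_refl)
    have "F \<subseteq> \<A>" using F(1) \<B>(1) unfolding \<B>'_def by blast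
    then have "infinite (Y - \<Union>F)" using infinite_Diff_if_finitely_many[OF Y F(2)] by blast
    moreover have "finite ((Y - \<Union>F) \<inter> B)" if "B \<in> \<B>" for B
    proof (cases "B \<in> \<B>'")
      case True
      then obtain B' where "B' \<in> F" "e -` B = e -` B'" using F(3) by (metis image_iff)
      then have "B \<inter> Y = B' \<inter> Y" using eB by metis
      then have "(Y - \<Union>F) \<inter> B = {}" using \<open>B' \<in> F\<close> by blast
      then show ?thesis by simp
    next
      case False
      then have "finite (B \<inter> Y)" using that unfolding \<B>'_def by blast
      then show ?thesis by (rule rev_finite_subset) blast
    qed
    ultimately show ?thesis using that[of "Y - \<Union>F"] by blast
  next
    case False
    let ?\<C> = "(\<lambda>B. e -` B) ` \<B>'"
    have ad': "almost_disjoint ?\<C>"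
      unfolding almost_disjoint_def
    proof (intro conjI ballI impI)
      fix C assume "C \<in> ?\<C>"
      then obtain B where "B \<in> \<B>'" "C = e -` B" by blast
      then have "infinite (e ` C)" using eB[of B] unfolding \<B>'_def by simp
      then show "infinite C" by blast
      fix C' assume "C' \<in> ?\<C>" "C \<noteq> C'"
      then obtain B' where B': "B' \<in> \<B>'" "C' = e -` B'" by blast
      then have "B \<noteq> B'" "B \<in> \<A>" "B' \<in> \<A>"
        using \<open>C \<noteq> C'\<close> \<open>C = e -` B\<close> \<open>B \<in> \<B>'\<close> \<B>(1) unfolding \<B>'_def by auto
      then have "finite (B \<inter> B')" using ad unfolding almost_disjoint_def by metis
      then have "finite (e -` (B \<inter> B'))" using e(1) by (rule finite_vimageI)
      then show "finite (C \<inter> C')" using B'(2) \<open>C = e -` B\<close> by (simp add: vimage_Int)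
    qed
    have "small \<B>'" using \<B>(2) by (rule small_subset) (auto simp: \<B>'_def)
    then have "\<not> MAD ?\<C>" using no_small_MAD False small_image by blast
    then obtain \<D> where \<D>: "almost_disjoint \<D>" "?\<C> \<subseteq> \<D>" "\<D> \<noteq> ?\<C>"
      using ad' unfolding MAD_def by metis
    then obtain C where C: "C \<in> \<D>" "C \<notin> ?\<C>" by blast
    have "infinite C" using C(1) \<D>(1) unfolding almost_disjoint_def by metis
    then have "infinite (e ` C)" using e(1) by (metis finite_imageD inj_on_subset subset_UNIV)
    moreover have "e ` C \<subseteq> Y" using e(2) by blast
    moreover have "finite (e ` C \<inter> B)" if "B \<in> \<B>" for B
    proof (cases "B \<in> \<B>'")
      case True
      then have "e -` B \<in> \<D>" "e -` B \<noteq> C" using \<D>(2) C(2) by auto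
      then have "finite (C \<inter> e -` B)" using C(1) \<D>(1) unfolding almost_disjoint_def by metis
      then have "finite (e ` (C \<inter> e -` B))" by simp
      then show ?thesis by (rule rev_finite_subset) auto
    next
      case False
      then have "finite (B \<inter> Y)" using that unfolding \<B>'_def by blast
      then show ?thesis by (rule rev_finite_subset) (use e(2) in auto)
    qed
    ultimately show ?thesis using that by blast
  qed
qed

text \<open>Positivity is reduced to countably many infinite sets, so that it can be handled by
  \<open>splitting\<close>. The witnesses are either what remains of \<open>X\<close> after removing
  the finitely many members with infinite trace, or countably many infinite traces.\<close>

lemma positive_witnesses:
  assumes ad: "almost_disjoint \<A>" and X: "X \<notin> ideal_of \<A>"
  shows "\<exists>w :: nat \<Rightarrow> nat set. (\<forall>k. infinite (w k)) \<and>
      (\<forall>P. (\<forall>k. infinite (w k \<inter> P)) \<longrightarrow> X \<inter> P \<notin> ideal_of \<A>)"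
proof (cases "finite {A \<in> \<A>. infinite (A \<inter> X)}")
  case True
  define Y where "Y = X - \<Union>{A \<in> \<A>. infinite (A \<inter> X)}"
  have "infinite Y" unfolding Y_def using infinite_Diff_if_finitely_many[OF X True] by blast
  have Yad: "finite (Y \<inter> A)" if "A \<in> \<A>" for A
  proof (cases "finite (A \<inter> X)")
    case True
    then show ?thesis by (rule rev_finite_subset) (auto simp: Y_def)
  next
    case False
    then have "Y \<inter> A = {}" using that unfolding Y_def by blast
    then show ?thesis by simp
  qed
  have "X \<inter> P \<notin> ideal_of \<A>" if "infinite (Y \<inter> P)" for P
  proof (rule not_ideal_of_if_almost_disjoint[OF that])
    show "Y \<inter> P \<subseteq> X \<inter> P" unfolding Y_def by auto
    show "finite (Y \<inter> P \<inter> A)" if "A \<in> \<A>" for A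
      using Yad[OF that] by (rule rev_finite_subset) blast
  qed
  then show ?thesis using \<open>infinite Y\<close> by (intro exI[of _ "\<lambda>_. Y"]) simp
next
  case False
  then obtain B :: "nat \<Rightarrow> nat set" where B: "inj B" "range B \<subseteq> {A \<in> \<A>. infinite (A \<inter> X)}"
    using infinite_countable_subset by blast
  have "X \<inter> P \<notin> ideal_of \<A>" if "\<forall>k. infinite (B k \<inter> X \<inter> P)" for P
  proof -
    have "range B \<subseteq> {A \<in> \<A>. infinite (A \<inter> (X \<inter> P))}"
      using B(2) that by (auto simp: Int_assoc)
    then have "infinite {A \<in> \<A>. infinite (A \<inter> (X \<inter> P))}"
      using B(1) finite_subset range_inj_infinite by metis
    then show ?thesis by (rule not_ideal_of_if_infinitely_many[OF ad])
  qed
  then show ?thesis using B(2) by (intro exI[of _ "\<lambda>k. B k \<inter> X"]) blast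
qed

text \<open>One index splits the witnesses of all the \<open>X n\<close> simultaneously; the pairing
  function merges the two indices into one sequence.\<close>

lemma positive_split:
  fixes X :: "nat \<Rightarrow> nat set"
  assumes ad: "almost_disjoint \<A>" and X: "\<And>n. X n \<notin> ideal_of \<A>"
  obtains a where "a \<in> D" "\<forall>n. X n \<inter> S a \<notin> ideal_of \<A> \<and> X n - S a \<notin> ideal_of \<A>"
proof -
  have "\<forall>n. \<exists>w :: nat \<Rightarrow> nat set. (\<forall>k. infinite (w k)) \<and>
      (\<forall>P. (\<forall>k. infinite (w k \<inter> P)) \<longrightarrow> X n \<inter> P \<notin> ideal_of \<A>)"
    using positive_witnesses[OF ad X] by blast
  from choice[OF this] obtain w :: "nat \<Rightarrow> nat \<Rightarrow> nat set" where
    w: "\<And>n k. infinite (w n k)" "\<And>n P. \<forall>k. infinite (w n k \<inter> P) \<Longrightarrow> X n \<inter> P \<notin> ideal_of \<A>"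
    by blast
  let ?w = "\<lambda>m. w (fst (prod_decode m)) (snd (prod_decode m))"
  obtain a where a: "a \<in> D" "\<And>m. infinite (?w m \<inter> S a) \<and> infinite (?w m - S a)"
    using splitting[of ?w] w(1) by blast
  have "infinite (w n k \<inter> S a) \<and> infinite (w n k \<inter> - S a)" for n k
    using a(2)[of "prod_encode (n, k)"] by (simp add: Diff_eq)
  then have "X n \<inter> S a \<notin> ideal_of \<A> \<and> X n \<inter> - S a \<notin> ideal_of \<A>" for n using w(2) by blast
  then show ?thesis using that[OF a(1)] by (simp add: Diff_eq)
qed

definition agree :: "'k \<Rightarrow> ('k \<Rightarrow> bool) \<Rightarrow> ('k \<Rightarrow> bool) \<Rightarrow> bool" where
  "agree a y y' \<longleftrightarrow> (\<forall>b\<in>D. b \<sqsubset> a \<longrightarrow> y b = y' b)"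

text \<open>A triple \<open>(A, a, y)\<close> attaches to \<open>A\<close> the node \<open>y\<close> restricted to the predecessors of \<open>a\<close>.\<close>

definition coherent :: "(nat set \<times> 'k \<times> ('k \<Rightarrow> bool)) set \<Rightarrow> bool" where
  "coherent E \<longleftrightarrow>
     (\<forall>A a y. (A, a, y) \<in> E \<longrightarrow>
        infinite A \<and> a \<in> D \<and> (\<forall>b\<in>D. b \<sqsubset> a \<longrightarrow> finite (A - side b (y b)))) \<and>
     (\<forall>A a y A' a' y'. (A, a, y) \<in> E \<and> (A', a', y') \<in> E \<and> (A, a, y) \<noteq> (A', a', y') \<longrightarrow>
        finite (A \<inter> A') \<and> (a = a' \<longrightarrow> \<not> agree a y y'))"

lemma coherent_almost_disjoint: "coherent E \<Longrightarrow> almost_disjoint (fst ` E)"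
  unfolding coherent_def almost_disjoint_def
  by (intro conjI ballI impI; elim imageE; clarsimp)

end

section \<open>One stage of the recursion: cutting positive sets and finding new members\<close>

locale stage = splitting_index D lt S for D :: "'k set" and lt (infix "\<sqsubset>" 50) and S +
  fixes E :: "(nat set \<times> 'k \<times> ('k \<Rightarrow> bool)) set"
  assumes coherent: "coherent E" and card_E: "|E| <o |UNIV :: (nat \<Rightarrow> bool) set|"
begin

abbreviation I where "I \<equiv> ideal_of (fst ` E)"

lemma ad: "almost_disjoint (fst ` E)"
  using coherent by (rule coherent_almost_disjoint)

definition above :: "'k \<Rightarrow> ('k \<Rightarrow> bool) \<Rightarrow> nat set \<Rightarrow> bool" where
  "above a y X \<longleftrightarrow> X \<notin> I \<and> (\<forall>b\<in>D. b \<sqsubset> a \<longrightarrow> X - side b (y b) \<in> I)"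

lemma above_subset: "above a y X \<Longrightarrow> X' \<subseteq> X \<Longrightarrow> X' \<notin> I \<Longrightarrow> above a y X'"
  unfolding above_def by (meson Diff_mono ideal_of_subset order_refl)

lemma above_cong: "agree a y y' \<Longrightarrow> above a y X \<Longrightarrow> above a y' X"
  unfolding above_def agree_def by auto

text \<open>If the bits differed, \<open>X'\<close> would be covered by two ideal sets, one missing
  each side of \<open>S b\<close>.\<close>

lemma above_unique:
  assumes "above a y X" "above a' y' X'" "X' \<subseteq> X" "b \<in> D" "b \<sqsubset> a" "b \<sqsubset> a'"
  shows "y b = y' b"
proof (rule ccontr)
  assume "y b \<noteq> y' b"
  then have "y' b = (\<not> y b)" by blast
  have "X - side b (y b) \<in> I" "X' - side b (y' b) \<in> I" using assms unfolding above_def by auto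
  then have "(X - side b (y b)) \<union> (X' - side b (\<not> y b)) \<in> I"
    using \<open>y' b = (\<not> y b)\<close> by (intro ideal_of_Un) simp_all
  then have "X' \<in> I" by (rule ideal_of_subset) (use assms(3) in \<open>auto simp: side_Not\<close>)
  then show False using assms(2) unfolding above_def by blast
qed

definition cut_pt :: "nat set \<Rightarrow> 'k" where
  "cut_pt X = (SOME a. a \<in> D \<and> (X \<inter> S a \<notin> I \<and> X - S a \<notin> I) \<and>
     (\<forall>b\<in>D. b \<sqsubset> a \<longrightarrow> \<not> (X \<inter> S b \<notin> I \<and> X - S b \<notin> I)))"

text \<open>Below \<open>cut_pt X\<close> exactly one side of \<open>X\<close> is positive, and
  \<open>dir\<close> records which one; from the cut on the bit carries no such meaning.\<close>

definition dir :: "nat set \<Rightarrow> 'k \<Rightarrow> bool" where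
  "dir X b \<longleftrightarrow> X \<inter> S b \<notin> I"

definition half :: "nat set \<Rightarrow> bool \<Rightarrow> nat set" where
  "half X i = X \<inter> side (cut_pt X) i"

lemma
  assumes X: "X \<notin> I"
  shows cut_in: "cut_pt X \<in> D" and half_positive: "half X i \<notin> I"
    and above_cut: "above (cut_pt X) (dir X) X"
proof -
  obtain a where "a \<in> D" "X \<inter> S a \<notin> I \<and> X - S a \<notin> I"
    using positive_split[OF ad, of "\<lambda>_. X"] X by blast
  from lt_least[of a "\<lambda>a. X \<inter> S a \<notin> I \<and> X - S a \<notin> I", OF this]
  have *: "cut_pt X \<in> D \<and> (X \<inter> S (cut_pt X) \<notin> I \<and> X - S (cut_pt X) \<notin> I) \<and>
     (\<forall>b\<in>D. b \<sqsubset> cut_pt X \<longrightarrow> \<not> (X \<inter> S b \<notin> I \<and> X - S b \<notin> I))"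
    unfolding cut_pt_def Bex_def by (rule someI_ex)
  then show "cut_pt X \<in> D" "half X i \<notin> I" by (auto simp: half_def side_def Diff_eq)
  have "X - side b (dir X b) \<in> I" if "b \<in> D" "b \<sqsubset> cut_pt X" for b
  proof -
    have "\<not> (X \<inter> S b \<notin> I \<and> X - S b \<notin> I)" using * that by blast
    then show ?thesis by (auto simp: dir_def side_def)
  qed
  then show "above (cut_pt X) (dir X) X" using X unfolding above_def by blast
qed

text \<open>Both halves are positive at the cut, so no node of greater height can be followed modulo
  the ideal.\<close>

lemma above_le_cut:
  assumes "above a y X" "a \<in> D"
  shows "a = cut_pt X \<or> a \<sqsubset> cut_pt X"
proof (rule ccontr)
  assume not_le: "\<not> ?thesis"
  have X: "X \<notin> I" using assms(1) unfolding above_def by blast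
  then have "cut_pt X \<sqsubset> a" using not_le lt_total[OF assms(2) cut_in] by blast
  then have "X - side (cut_pt X) (y (cut_pt X)) \<in> I" using assms(1) cut_in[OF X] unfolding above_def by blast
  then have "half X (\<not> y (cut_pt X)) \<in> I" by (simp add: half_def side_Not Diff_eq)
  then show False using half_positive[OF X] by blast
qed

lemma half_subset: "half X i \<subseteq> X"
  by (simp add: half_def)

text \<open>A half keeps all earlier decisions of \<open>X\<close> and has empty opposite side at
  the old cut. Its own cut therefore comes strictly later, and its node passes through the old cut
  with bit \<open>i\<close>.\<close>

lemma cut_half:
  assumes X: "X \<notin> I"
  shows "cut_pt X \<sqsubset> cut_pt (half X i)" and "dir (half X i) (cut_pt X) = i"
proof -
  have h: "half X i \<notin> I" using half_positive[OF X] .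
  have e: "half X i - side (cut_pt X) i = {}" by (auto simp: half_def)
  have "above (cut_pt X) (dir X) (half X i)"
    using above_subset[OF above_cut[OF X] half_subset h] .
  then have "cut_pt X = cut_pt (half X i) \<or> cut_pt X \<sqsubset> cut_pt (half X i)"
    using above_le_cut cut_in[OF X] by blast
  moreover have "cut_pt X \<noteq> cut_pt (half X i)"
  proof
    assume "cut_pt X = cut_pt (half X i)"
    then have "half (half X i) (\<not> i) = {}" by (auto simp: half_def side_Not)
    then show False using half_positive[OF h, of "\<not> i"] ideal_of_finite by simp
  qed
  ultimately show lt: "cut_pt X \<sqsubset> cut_pt (half X i)" by blast
  have "half X i - side (cut_pt X) (dir (half X i) (cut_pt X)) \<in> I"
    using above_cut[OF h] cut_in[OF X] lt unfolding above_def by blast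
  moreover have "half X i - side (cut_pt X) (\<not> i) = half X i" by (auto simp: half_def side_Not)
  ultimately show "dir (half X i) (cut_pt X) = i" using h by (cases "dir (half X i) (cut_pt X) = i") auto
qed

primrec halves :: "nat set \<Rightarrow> (nat \<Rightarrow> bool) \<Rightarrow> nat \<Rightarrow> nat set" where
  "halves X r 0 = X"
| "halves X r (Suc n) = half (halves X r n) (r n)"

lemma halves_positive: "X \<notin> I \<Longrightarrow> halves X r n \<notin> I"
  by (induction n) (auto simp: half_positive)

lemma halves_antimono: "antimono (halves X r)"
  by (simp add: antimono_iff_le_Suc half_subset)

lemma halves_cong: "(\<And>i. i < n \<Longrightarrow> r i = r' i) \<Longrightarrow> halves X r n = halves X r' n"
  by (induction n) auto

text \<open>Halving along \<open>r\<close> gives increasing cuts, and \<open>b\<close> is their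
  least strict upper bound, so the nodes of the successive halves unite to a node of height
  \<open>b\<close>. The bits of \<open>r\<close> can be read off at the cuts, which makes nodes of
  different strings incompatible.\<close>

lemma halves_node:
  assumes X: "X \<notin> I"
  obtains b y where "b \<in> D" "\<And>n. cut_pt (halves X r n) \<sqsubset> b"
    "\<And>c. c \<in> D \<Longrightarrow> c \<sqsubset> b \<Longrightarrow> \<exists>n. c \<sqsubset> cut_pt (halves X r n)"
    "\<And>n. above (cut_pt (halves X r n)) y (halves X r n)" "\<And>n. y (cut_pt (halves X r n)) = r n"
proof -
  let ?a = "\<lambda>n. cut_pt (halves X r n)"
  have aD: "?a n \<in> D" for n using cut_in[OF halves_positive[OF X]] .
  have a_Suc: "?a n \<sqsubset> ?a (Suc n)" for n using cut_half(1)[OF halves_positive[OF X]] by simp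
  have "countable (range ?a)" "range ?a \<subseteq> D" using aD by auto
  from countable_bounded[OF this] obtain a where "a \<in> D" "\<forall>n. ?a n \<sqsubset> a" by blast
  from lt_least[of a "\<lambda>a. \<forall>n. ?a n \<sqsubset> a", OF this] obtain b where
    b: "b \<in> D" "\<And>n. ?a n \<sqsubset> b" "\<And>c. c \<in> D \<Longrightarrow> c \<sqsubset> b \<Longrightarrow> \<exists>n. \<not> ?a n \<sqsubset> c" by blast
  have cof: "\<exists>n. c \<sqsubset> ?a n" if c: "c \<in> D" "c \<sqsubset> b" for c
  proof -
    obtain n where "\<not> ?a n \<sqsubset> c" using b(3)[OF c] by blast
    then have "c = ?a n \<or> c \<sqsubset> ?a n" using lt_total[OF c(1) aD] by blast
    then have "c \<sqsubset> ?a (Suc n)" using a_Suc[of n] lt_trans by blast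
    then show ?thesis by blast
  qed
  \<comment> \<open>Any stage whose cut lies above \<open>c\<close> gives the same bit, by
    \<open>above_unique\<close>, so the choice is harmless.\<close>
  define y where "y c = dir (halves X r (SOME n. c \<sqsubset> ?a n)) c" for c
  have y: "y c = dir (halves X r n) c" if c: "c \<in> D" "c \<sqsubset> ?a n" for c n
  proof -
    define m where "m = (SOME n. c \<sqsubset> ?a n)"
    have m: "c \<sqsubset> ?a m" unfolding m_def using c(2) by (rule someI)
    have abv: "above (?a k) (dir (halves X r k)) (halves X r k)" for k
      using above_cut[OF halves_positive[OF X]] .
    have "dir (halves X r m) c = dir (halves X r n) c"
    proof (cases "m \<le> n")
      case True
      then show ?thesis
        using above_unique[OF abv abv antimonoD[OF halves_antimono True] c(1) m c(2)] by simp
    next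
      case False
      then have "n \<le> m" by simp
      then show ?thesis
        using above_unique[OF abv abv antimonoD[OF halves_antimono \<open>n \<le> m\<close>] c(1) c(2) m] by simp
    qed
    then show ?thesis by (simp add: y_def m_def)
  qed
  have "above (?a n) y (halves X r n)" for n
    using y above_cong[OF _ above_cut[OF halves_positive[OF X]]] unfolding agree_def by metis
  moreover have "y (?a n) = r n" for n
    using y[OF aD a_Suc] cut_half(2)[OF halves_positive[OF X]] by simp
  ultimately show ?thesis using that b(1,2) cof by blast
qed

text \<open>Coherence allows at most one triple per node, and the proper initial segments of a fixed
  node are determined by their heights.\<close>

lemma card_below_node:
  assumes "b \<in> D"
  shows "|{A. \<exists>b' y'. (A, b', y') \<in> E \<and> b' \<sqsubset> b \<and> agree b' y' y}| \<le>o |{c \<in> D. c \<sqsubset> b}|"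
proof -
  define P where "P = {e \<in> E. fst (snd e) \<sqsubset> b \<and> agree (fst (snd e)) (snd (snd e)) y}"
  have "inj_on (\<lambda>e. fst (snd e)) P"
  proof (rule inj_onI)
    fix e e' assume *: "e \<in> P" "e' \<in> P" "fst (snd e) = fst (snd e')"
    obtain A b y1 A' b' y2 where e: "e = (A, b, y1)" "e' = (A', b', y2)" by (metis prod.collapse)
    then have "b = b'" "agree b y1 y2" using * unfolding P_def agree_def by auto
    then show "e = e'" using coherent * e unfolding coherent_def P_def by blast
  qed
  moreover have "(\<lambda>e. fst (snd e)) ` P \<subseteq> {c \<in> D. c \<sqsubset> b}"
    using coherent unfolding P_def coherent_def by auto
  ultimately have "|P| \<le>o |{c \<in> D. c \<sqsubset> b}|" by (meson card_of_ordLeq)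
  moreover have "|fst ` P| \<le>o |P|" by (rule card_of_image)
  moreover have "{A. \<exists>b' y'. (A, b', y') \<in> E \<and> b' \<sqsubset> b \<and> agree b' y' y} \<subseteq> fst ` P"
    by (force simp: P_def image_iff)
  ultimately show ?thesis by (meson card_of_mono1 ordLeq_transitive)
qed

text \<open>A positive pseudo-intersection follows the node \<open>y\<close> modulo the ideal. It is
  thinned out to be almost disjoint from a small set of members: those attached to proper initial
  segments of the node, and the finitely many responsible for the error at each \<open>c\<close>
  below \<open>b\<close>. By \<open>new\<close> the remaining members have incompatible nodes, so
  almost disjointness from them is automatic.\<close>

lemma new_set:
  assumes b: "b \<in> D" and dec: "antimono X'" and X'0: "X' 0 = X"
    and cof: "\<And>c. c \<in> D \<Longrightarrow> c \<sqsubset> b \<Longrightarrow> \<exists>n. X' n - side c (y c) \<in> I"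
    and pos: "\<And>n :: nat. X' n \<notin> I"
    and new: "\<And>A b' y'. (A, b', y') \<in> E \<Longrightarrow> b = b' \<or> b \<sqsubset> b' \<Longrightarrow> \<not> agree b y y'"
  shows "\<exists>Z. Z \<subseteq> X \<and> infinite Z \<and> (\<forall>c\<in>D. c \<sqsubset> b \<longrightarrow> finite (Z - side c (y c))) \<and>
      (\<forall>A\<in>fst ` E. finite (Z \<inter> A))"
proof -
  obtain Y where Y: "Y \<subseteq> X" "\<And>n. finite (Y - X' n)" "Y \<notin> I"
    using positive_pseudo_intersection[OF ad dec] pos X'0 by metis
  have "Y - side c (y c) \<in> I" if c: "c \<in> D" "c \<sqsubset> b" for c
  proof -
    obtain n where "X' n - side c (y c) \<in> I" using cof[OF c] by blast
    then have "(X' n - side c (y c)) \<union> (Y - X' n) \<in> I"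
      using Y(2) ideal_of_Un ideal_of_finite by metis
    then show ?thesis by (rule ideal_of_subset) blast
  qed
  then have "\<forall>c\<in>{c \<in> D. c \<sqsubset> b}. \<exists>F. finite F \<and> F \<subseteq> fst ` E \<and> finite (Y - side c (y c) - \<Union>F)"
    unfolding ideal_of_iff by blast
  then obtain F where F: "\<And>c. c \<in> D \<Longrightarrow> c \<sqsubset> b \<Longrightarrow>
      finite (F c) \<and> F c \<subseteq> fst ` E \<and> finite (Y - side c (y c) - \<Union>(F c))"
    by (metis (mono_tags, lifting) mem_Collect_eq)
  define P where "P = {A. \<exists>b' y'. (A, b', y') \<in> E \<and> b' \<sqsubset> b \<and> agree b' y' y}"
  define \<B> where "\<B> = P \<union> (\<Union>c\<in>{c \<in> D. c \<sqsubset> b}. F c)"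
  have "small (\<Union>c\<in>{c \<in> D. c \<sqsubset> b}. F c)"
    using F by (intro small_UN_countable[OF small_below[OF b]]) (simp add: countable_finite)
  then have "small \<B>" unfolding \<B>_def P_def by (intro small_Un small_le[OF small_below[OF b] card_below_node[OF b]])
  moreover have "\<B> \<subseteq> fst ` E"
  proof -
    have "P \<subseteq> fst ` E" unfolding P_def by (auto intro: rev_image_eqI)
    moreover have "(\<Union>c\<in>{c \<in> D. c \<sqsubset> b}. F c) \<subseteq> fst ` E" using F by blast
    ultimately show ?thesis unfolding \<B>_def by blast
  qed
  ultimately obtain Z where Z: "Z \<subseteq> Y" "infinite Z" "\<And>B. B \<in> \<B> \<Longrightarrow> finite (Z \<inter> B)"
    using almost_disjoint_from_small[OF ad Y(3)] by metis
  have side: "finite (Z - side c (y c))" if c: "c \<in> D" "c \<sqsubset> b" for c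
  proof -
    have "finite (\<Union>B\<in>F c. Z \<inter> B)" using F[OF c] Z(3) c by (intro finite_UN_I) (auto simp: \<B>_def)
    then have "finite ((Y - side c (y c) - \<Union>(F c)) \<union> (\<Union>B\<in>F c. Z \<inter> B))" using F[OF c] by blast
    then show ?thesis by (rule rev_finite_subset) (use Z(1) in auto)
  qed
  have "finite (Z \<inter> A)" if "A \<in> fst ` E" for A
  proof (cases "A \<in> P")
    case True
    then show ?thesis using Z(3) unfolding \<B>_def by blast
  next
    case False
    obtain b' y' where E: "(A, b', y') \<in> E" using \<open>A \<in> fst ` E\<close> by auto
    have b': "b' \<in> D" using E coherent unfolding coherent_def by blast
    \<comment> \<open>At such a \<open>c\<close> the sets \<open>A\<close> and \<open>Z\<close> lie
      almost in opposite sides of \<open>S c\<close>.\<close>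
    have "\<exists>c\<in>D. c \<sqsubset> b \<and> c \<sqsubset> b' \<and> y' c \<noteq> y c"
    proof (cases "b' \<sqsubset> b")
      case True
      then have "\<not> agree b' y' y" using False E unfolding P_def by blast
      then show ?thesis using True lt_trans unfolding agree_def by blast
    next
      case False
      then have "b = b' \<or> b \<sqsubset> b'" using lt_total[OF b b'] by blast
      then have "\<not> agree b y y'" using new[OF E] by blast
      then show ?thesis using \<open>b = b' \<or> b \<sqsubset> b'\<close> lt_trans unfolding agree_def by metis
    qed
    then obtain c where c: "c \<in> D" "c \<sqsubset> b" "c \<sqsubset> b'" "y' c = (\<not> y c)" by blast
    have "finite (A - side c (y' c))" using E coherent c unfolding coherent_def by blast
    then have "finite ((A - side c (y' c)) \<union> (Z - side c (y c)))" using side[OF c(1,2)] by blast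
    then show ?thesis by (rule rev_finite_subset) (use c(4) in \<open>auto simp: side_Not\<close>)
  qed
  then show ?thesis using Z(1,2) Y(1) side by (intro exI[of _ Z]) blast
qed

text \<open>The bit strings give continuum many pairwise incompatible nodes below \<open>X\<close>.
  A triple of \<open>E\<close> blocks a node only if its own node equals or extends it, so each
  triple blocks at most one string. As \<open>E\<close> is smaller than the continuum, infinitely
  many strings remain for \<open>new_set\<close>. Countably many new members are taken at once,
  which lets a set containing all of them stay positive.\<close>

lemma fresh:
  assumes X: "X \<notin> I"
  obtains W where "countable W" "infinite W" "coherent (E \<union> W)"
    "\<forall>Z\<in>fst ` W. Z \<subseteq> X \<and> infinite Z \<and> (\<forall>A\<in>fst ` E. finite (Z \<inter> A))"
proof -
  have "\<forall>r. \<exists>b y. b \<in> D \<and> (\<forall>n. cut_pt (halves X r n) \<sqsubset> b) \<and>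
      (\<forall>c\<in>D. c \<sqsubset> b \<longrightarrow> (\<exists>n. c \<sqsubset> cut_pt (halves X r n))) \<and>
      (\<forall>n. above (cut_pt (halves X r n)) y (halves X r n)) \<and> (\<forall>n. y (cut_pt (halves X r n)) = r n)"
    using halves_node[OF X] by metis
  then obtain nb ny where n: "\<And>r. nb r \<in> D" "\<And>r n. cut_pt (halves X r n) \<sqsubset> nb r"
    "\<And>r c. c \<in> D \<Longrightarrow> c \<sqsubset> nb r \<Longrightarrow> \<exists>n. c \<sqsubset> cut_pt (halves X r n)"
    "\<And>r n. above (cut_pt (halves X r n)) (ny r) (halves X r n)"
    "\<And>r n. ny r (cut_pt (halves X r n)) = r n" by metis
  have incompatible: "\<exists>c\<in>D. c \<sqsubset> nb r \<and> c \<sqsubset> nb r' \<and> ny r c \<noteq> ny r' c" if "r \<noteq> r'" for r r'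
  proof -
    define k where "k = (LEAST k. r k \<noteq> r' k)"
    have k: "r k \<noteq> r' k" "\<And>i. i < k \<Longrightarrow> r i = r' i"
      using that LeastI_ex[of "\<lambda>k. r k \<noteq> r' k"] not_less_Least unfolding k_def by blast+
    then have eq: "halves X r k = halves X r' k" by (intro halves_cong)
    show ?thesis
    proof (intro bexI conjI)
      show "cut_pt (halves X r k) \<in> D" using cut_in[OF halves_positive[OF X]] .
      show "cut_pt (halves X r k) \<sqsubset> nb r" by (rule n(2))
      show "cut_pt (halves X r k) \<sqsubset> nb r'" unfolding eq by (rule n(2))
      show "ny r (cut_pt (halves X r k)) \<noteq> ny r' (cut_pt (halves X r k))"
        using n(5)[of r k] n(5)[of r' k] k(1) eq by metis
    qed
  qed
  define Bad where "Bad = {r. \<exists>e\<in>E. (nb r = fst (snd e) \<or> nb r \<sqsubset> fst (snd e)) \<and> agree (nb r) (ny r) (snd (snd e))}"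
  define G where "G = - Bad"
  have "\<forall>r\<in>Bad. \<exists>e. e \<in> E \<and> (nb r = fst (snd e) \<or> nb r \<sqsubset> fst (snd e)) \<and>
      agree (nb r) (ny r) (snd (snd e))"
    unfolding Bad_def by blast
  from bchoice[OF this] obtain \<epsilon> where \<epsilon>: "\<And>r. r \<in> Bad \<Longrightarrow> \<epsilon> r \<in> E \<and> (nb r = fst (snd (\<epsilon> r)) \<or> nb r \<sqsubset> fst (snd (\<epsilon> r))) \<and>
      agree (nb r) (ny r) (snd (snd (\<epsilon> r)))"
    by blast
  \<comment> \<open>One triple cannot extend two nodes that disagree at a coordinate below both
    heights.\<close>
  have "inj_on \<epsilon> Bad"
  proof (rule inj_onI, rule ccontr)
    fix r r' assume r: "r \<in> Bad" "r' \<in> Bad" "\<epsilon> r = \<epsilon> r'" "r \<noteq> r'"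
    obtain c where "c \<in> D" "c \<sqsubset> nb r" "c \<sqsubset> nb r'" "ny r c \<noteq> ny r' c" using incompatible[OF r(4)] by blast
    then show False using \<epsilon>[OF r(1)] \<epsilon>[OF r(2)] r(3) unfolding agree_def by metis
  qed
  moreover have "\<epsilon> ` Bad \<subseteq> E" using \<epsilon> by blast
  ultimately have "|Bad| <o |UNIV :: (nat \<Rightarrow> bool) set|"
    using card_E ordLeq_ordLess_trans card_of_ordLeq by metis
  have infinite_reals: "infinite (UNIV :: (nat \<Rightarrow> bool) set)"
    using finite_fun_UNIVD1[where ?'a = nat and ?'b = bool] by force
  have "infinite G"
  proof
    assume "finite G"
    then have "|G| <o |UNIV :: (nat \<Rightarrow> bool) set|"
      using infinite_reals finite_ordLess_infinite[of "|G|" "|UNIV :: (nat \<Rightarrow> bool) set|"]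
      by (simp add: Field_card_of card_of_well_order_on)
    then have "|Bad \<union> G| <o |UNIV :: (nat \<Rightarrow> bool) set|"
      using card_of_Un_ordLess_infinite[OF infinite_reals] \<open>|Bad| <o _\<close> by blast
    then show False unfolding G_def by (simp add: ordLess_irreflexive)
  qed
  then obtain \<rho> :: "nat \<Rightarrow> nat \<Rightarrow> bool" where \<rho>: "inj \<rho>" "range \<rho> \<subseteq> G"
    using infinite_countable_subset by blast
  have "\<exists>Z. Z \<subseteq> X \<and> infinite Z \<and> (\<forall>c\<in>D. c \<sqsubset> nb r \<longrightarrow> finite (Z - side c (ny r c))) \<and>
      (\<forall>A\<in>fst ` E. finite (Z \<inter> A))" if r: "r \<in> G" for r
  proof -
    have cof: "\<exists>n. halves X r n - side c (ny r c) \<in> I" if "c \<in> D" "c \<sqsubset> nb r" for c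
      using n(3)[OF that] n(4)[of r] that(1) unfolding above_def by blast
    have new: "\<not> agree (nb r) (ny r) y'"
      if "(A, b', y') \<in> E" "nb r = b' \<or> nb r \<sqsubset> b'" for A b' y'
      using r that unfolding G_def Bad_def by force
    show ?thesis
    proof (rule new_set[OF n(1)[of r] halves_antimono[of X r] halves.simps(1), of "ny r"])
      show "\<exists>n. halves X r n - side c (ny r c) \<in> I" if "c \<in> D" "c \<sqsubset> nb r" for c
        using cof[OF that] .
      show "halves X r k \<notin> I" for k by (rule halves_positive[OF X])
      show "\<not> agree (nb r) (ny r) y'" if "(A, b', y') \<in> E" "nb r = b' \<or> nb r \<sqsubset> b'" for A b' y'
        using new[OF that] .
    qed
  qed
  then obtain NZ where NZ: "\<And>r. r \<in> G \<Longrightarrow> NZ r \<subseteq> X \<and> infinite (NZ r) \<and>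
      (\<forall>c\<in>D. c \<sqsubset> nb r \<longrightarrow> finite (NZ r - side c (ny r c))) \<and> (\<forall>A\<in>fst ` E. finite (NZ r \<inter> A))"
    by metis
  define w where "w k = (NZ (\<rho> k), nb (\<rho> k), ny (\<rho> k))" for k
  have \<rho>G: "\<rho> k \<in> G" for k using \<rho>(2) by blast
  have "inj w"
  proof (rule injI, rule ccontr)
    fix i j assume "w i = w j" "i \<noteq> j"
    then have "\<rho> i \<noteq> \<rho> j" using \<rho>(1) by (meson injD)
    then show False using incompatible[of "\<rho> i" "\<rho> j"] \<open>w i = w j\<close> unfolding w_def by auto
  qed
  have ww: "finite (NZ (\<rho> i) \<inter> NZ (\<rho> j)) \<and> (nb (\<rho> i) = nb (\<rho> j) \<longrightarrow> \<not> agree (nb (\<rho> i)) (ny (\<rho> i)) (ny (\<rho> j)))"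
    if "w i \<noteq> w j" for i j
  proof -
    have "\<rho> i \<noteq> \<rho> j" using that unfolding w_def by auto
    then obtain c where c: "c \<in> D" "c \<sqsubset> nb (\<rho> i)" "c \<sqsubset> nb (\<rho> j)" "ny (\<rho> j) c = (\<not> ny (\<rho> i) c)"
      using incompatible[of "\<rho> i" "\<rho> j"] by blast
    have "finite ((NZ (\<rho> i) - side c (ny (\<rho> i) c)) \<union> (NZ (\<rho> j) - side c (ny (\<rho> j) c)))"
      using NZ[OF \<rho>G] c by blast
    then have "finite (NZ (\<rho> i) \<inter> NZ (\<rho> j))"
      by (rule rev_finite_subset) (use c(4) in \<open>auto simp: side_Not\<close>)
    then show ?thesis using c unfolding agree_def by auto
  qed
  have ew: "finite (A \<inter> NZ (\<rho> i))" "b = nb (\<rho> i) \<Longrightarrow> \<not> agree b y' (ny (\<rho> i))"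
    if e: "(A, b, y') \<in> E" for A b y' i
  proof -
    have "A \<in> fst ` E" using e by force
    then show "finite (A \<inter> NZ (\<rho> i))" using NZ[OF \<rho>G] by (metis Int_commute)
    show "\<not> agree b y' (ny (\<rho> i))" if "b = nb (\<rho> i)"
      using \<rho>G[of i] e that unfolding G_def Bad_def agree_def by force
  qed
  have "coherent (E \<union> range w)"
    unfolding coherent_def
  proof (rule conjI; intro allI impI)
    fix A b y' assume "(A, b, y') \<in> E \<union> range w"
    then show "infinite A \<and> b \<in> D \<and> (\<forall>c\<in>D. c \<sqsubset> b \<longrightarrow> finite (A - side c (y' c)))"
    proof
      assume "(A, b, y') \<in> E"
      then show ?thesis using coherent unfolding coherent_def by blast
    next
      assume "(A, b, y') \<in> range w"
      then show ?thesis using NZ[OF \<rho>G] n(1) unfolding w_def by auto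
    qed
  next
    fix A b y' A' b' y''
    assume *: "(A, b, y') \<in> E \<union> range w \<and> (A', b', y'') \<in> E \<union> range w \<and> (A, b, y') \<noteq> (A', b', y'')"
    then consider "(A, b, y') \<in> E" "(A', b', y'') \<in> E" | i where "(A, b, y') \<in> E" "(A', b', y'') = w i"
      | i where "(A, b, y') = w i" "(A', b', y'') \<in> E" | i j where "(A, b, y') = w i" "(A', b', y'') = w j"
      by blast
    then show "finite (A \<inter> A') \<and> (b = b' \<longrightarrow> \<not> agree b y' y'')"
    proof cases
      case 1
      then show ?thesis using coherent * unfolding coherent_def by blast
    next
      case 2
      then show ?thesis using ew[of A b y' i] unfolding w_def by auto
    next
      case 3
      then show ?thesis using ew[of A' b' y'' i] unfolding w_def agree_def by (auto simp: Int_commute)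
    next
      case 4
      then show ?thesis using ww[of i j] * unfolding w_def by auto
    qed
  qed
  moreover have "\<forall>Z\<in>fst ` range w. Z \<subseteq> X \<and> infinite Z \<and> (\<forall>A\<in>fst ` E. finite (Z \<inter> A))"
    using NZ[OF \<rho>G] unfolding w_def by auto
  moreover have "countable (range w)" "infinite (range w)"
    using \<open>inj w\<close> by (simp_all add: range_inj_infinite)
  ultimately show ?thesis using that[of "range w"] by simp
qed

end

section \<open>Branches with positive range\<close>

context stage
begin

text \<open>Positive successor sets are asked for only densely: the subtrees built below may have
  thin successor sets at intermediate nodes.\<close>

definition positive_tree :: "nat list set \<Rightarrow> bool" where
  "positive_tree Q \<longleftrightarrow> seq_tree Q \<and> (\<forall>s\<in>Q. \<exists>u\<in>Q. prefix s u \<and> suc_set Q u \<notin> I)"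

text \<open>The ideal error may vary with the node. Such errors are harmless later, because branches
  are built from numbers picked in sets almost disjoint from all members, which meet each error set
  finitely.\<close>

definition forces :: "nat list set \<Rightarrow> nat set \<Rightarrow> bool" where
  "forces Q B \<longleftrightarrow> (\<exists>J. (\<forall>u. J u \<in> I) \<and>
     (\<forall>f\<in>branches Q. \<forall>\<^sub>\<infinity>k. f k \<in> B \<union> J (map f [0..<k])))"

lemma forces_subtree: "forces Q B \<Longrightarrow> Q' \<subseteq> Q \<Longrightarrow> forces Q' B"
  unfolding forces_def branches_def by blast

text \<open>Against any assignment \<open>J\<close> of errors, a branch is built that at infinitely
  many positions takes a successor in \<open>B\<close> outside the error set of its node.\<close>

lemma not_forces_Compl:
  assumes Q: "seq_tree Q" and dense: "\<forall>s\<in>Q. \<exists>u\<in>Q. prefix s u \<and> suc_set Q u \<inter> B \<notin> I"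
  shows "\<not> forces Q (- B)"
proof
  assume "forces Q (- B)"
  then obtain J where J: "\<And>u. J u \<in> I" "\<And>f. f \<in> branches Q \<Longrightarrow> \<forall>\<^sub>\<infinity>k. f k \<in> - B \<union> J (map f [0..<k])"
    unfolding forces_def by blast
  from bchoice[OF dense[unfolded Bex_def]] obtain c where
    c: "\<And>s. s \<in> Q \<Longrightarrow> c s \<in> Q \<and> prefix s (c s) \<and> suc_set Q (c s) \<inter> B \<notin> I" by blast
  define Z0 where "Z0 s = suc_set Q (c s) \<inter> B - J (c s)" for s
  define st where "st l = foldl (\<lambda>s (n, b). if n \<in> Z0 s then c s @ [n] else s) [] l"
    for l :: "(nat \<times> bool) list"
  define U where "U l = c (st l)" for l
  define Z where "Z l = Z0 (st l)" for l
  have nil: "[] \<in> Q" using Q unfolding seq_tree_def by (metis Nil_prefix ex_in_conv)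
  have stQ: "st l \<in> Q" for l
    by (induction l rule: rev_induct) (auto simp: st_def nil Z0_def suc_set_def)
  have U: "\<forall>l. U l \<in> Q" using c[OF stQ] unfolding U_def by blast
  have step: "\<forall>l. \<forall>n\<in>Z l. \<forall>b. prefix (U l @ [n]) (U (l @ [(n, b)]))"
  proof (intro allI ballI)
    fix l n b assume "n \<in> Z l"
    then have "st (l @ [(n, b)]) = U l @ [n]" by (simp add: st_def U_def Z_def)
    then show "prefix (U l @ [n]) (U (l @ [(n, b)]))"
      using c[OF stQ, of "l @ [(n, b)]"] unfolding U_def by metis
  qed
  have "infinite (Z l)" for l
  proof
    assume "finite (Z l)"
    then have "Z l \<union> J (U l) \<in> I" using J(1) ideal_of_Un ideal_of_finite by blast
    then have "suc_set Q (U l) \<inter> B \<in> I" by (rule ideal_of_subset) (auto simp: Z_def Z0_def U_def)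
    then show False using c[OF stQ] unfolding U_def by blast
  qed
  then have "Z l \<noteq> {}" for l by (metis finite.emptyI)
  define v where "v l = (SOME n. n \<in> Z l)" for l
  have v: "\<forall>l. v l \<in> Z l" unfolding v_def using \<open>\<And>l. Z l \<noteq> {}\<close> by (simp add: some_in_eq)
  define p where "p = path v (\<lambda>_. True)"
  obtain f where f: "f \<in> branches Q" "\<forall>k. map f [0..<length (U (p k))] = U (p k)"
      "\<forall>k. f (length (U (p k))) = v (p k)"
    unfolding p_def using scheme_branch[OF Q U step v, of "\<lambda>_. True"] by metis
  obtain m where m: "\<And>k. m \<le> k \<Longrightarrow> f k \<in> - B \<union> J (map f [0..<k])"
    using J(2)[OF f(1)] unfolding MOST_nat_le by blast
  \<comment> \<open>Node \<open>m\<close> of the path is long enough for the eventual statement to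
    apply at its next entry.\<close>
  have "m \<le> length (U (p m))" unfolding p_def using scheme_prefix(3)[OF step v] .
  then have "v (p m) \<in> - B \<union> J (U (p m))" using m f(2,3) by metis
  then show False using v unfolding Z_def Z0_def U_def by blast
qed

text \<open>The union of the two error assignments would force the empty set, which a positive tree
  refutes.\<close>

lemma forces_not_Compl:
  assumes "positive_tree Q" "forces Q B"
  shows "\<not> forces Q (- B)"
proof
  assume "forces Q (- B)"
  then obtain J' where J': "\<And>u. J' u \<in> I" "\<And>f. f \<in> branches Q \<Longrightarrow> \<forall>\<^sub>\<infinity>k. f k \<in> - B \<union> J' (map f [0..<k])"
    unfolding forces_def by blast
  obtain J where J: "\<And>u. J u \<in> I" "\<And>f. f \<in> branches Q \<Longrightarrow> \<forall>\<^sub>\<infinity>k. f k \<in> B \<union> J (map f [0..<k])"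
    using assms(2) unfolding forces_def by blast
  have "forces Q (- UNIV)"
    unfolding forces_def
  proof (intro exI[of _ "\<lambda>u. J u \<union> J' u"] conjI allI ballI)
    show "J u \<union> J' u \<in> I" for u using J(1) J'(1) ideal_of_Un by blast
    show "\<forall>\<^sub>\<infinity>k. f k \<in> - UNIV \<union> (J (map f [0..<k]) \<union> J' (map f [0..<k]))" if "f \<in> branches Q" for f
      using J(2)[OF that] J'(2)[OF that] by eventually_elim auto
  qed
  moreover have "\<not> forces Q (- UNIV)"
    using assms(1) unfolding positive_tree_def by (intro not_forces_Compl) auto
  ultimately show False by blast
qed

text \<open>
  A node is decided if \<open>B\<close> is forced below it. If the root is undecided, the undecided nodes that are
  reached by leaving \<open>B\<close> contain a positive tree; steps into \<open>B\<close> are only needed to get from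
  a node to the nearest node with positively many undecided successors.
\<close>

lemma positive_subtree_avoiding:
  assumes Q: "positive_tree Q" and nf: "\<not> forces Q B"
  obtains Q' where "Q' \<subseteq> Q" "positive_tree Q'" "forces Q' (- B)"
proof -
  have tree: "seq_tree Q" using Q unfolding positive_tree_def by blast
  have nil: "[] \<in> Q" using tree unfolding seq_tree_def by (metis Nil_prefix ex_in_conv)
  \<comment> \<open>The forcing of \<open>B\<close> is localised to branches through
    \<open>s\<close>; at the root it is \<open>forces Q B\<close>. \<open>V u\<close> collects the
    steps outside \<open>B\<close> to undecided nodes, and a target is a node where these steps form
    a positive set.\<close>
  define dec where "dec s \<longleftrightarrow> (\<exists>J. (\<forall>u. J u \<in> I) \<and> (\<forall>f\<in>branches Q. map f [0..<length s] = s \<longrightarrow>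
      (\<forall>\<^sub>\<infinity>k. f k \<in> B \<union> J (map f [0..<k]))))" for s
  define V where "V u = {n \<in> suc_set Q u - B. \<not> dec (u @ [n])}" for u
  define target where "target s u \<longleftrightarrow> u \<in> Q \<and> prefix s u \<and> V u \<notin> I" for s u
  have dec_prefix: "dec s'" if "dec s" "prefix s s'" for s s'
  proof -
    have "map f [0..<length s] = s" if "map f [0..<length s'] = s'" for f :: "nat \<Rightarrow> nat"
    proof -
      have "map f [0..<length s] = take (length s) (map f [0..<length s'])"
        using prefix_length_le[OF \<open>prefix s s'\<close>] by (simp add: take_map)
      then show ?thesis using that \<open>prefix s s'\<close> by (metis append_eq_conv_conj prefix_def)
    qed
    then show ?thesis using \<open>dec s\<close> unfolding dec_def by blast
  qed
  \<comment> \<open>Without a target above \<open>s\<close>, one assignment would decide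
    \<open>s\<close>: at each node above \<open>s\<close> take \<open>V\<close> together with the
    errors of all decided prefixes. A branch through \<open>s\<close> either always stays in
    \<open>B\<close> or \<open>V\<close>, or leaves both once; its next node is then decided, and
    that node's errors serve from there on.\<close>
  have ex_target: "\<exists>u. target s u" if "\<not> dec s" for s
  proof (rule ccontr)
    assume none: "\<not> (\<exists>u. target s u)"
    have "\<forall>t. \<exists>J. dec t \<longrightarrow> (\<forall>u. J u \<in> I) \<and> (\<forall>f\<in>branches Q. map f [0..<length t] = t \<longrightarrow>
      (\<forall>\<^sub>\<infinity>k. f k \<in> B \<union> J (map f [0..<k])))" unfolding dec_def by blast
    from choice[OF this] obtain Jt where Jt: "\<And>t u. dec t \<Longrightarrow> Jt t u \<in> I"
      "\<And>t f. dec t \<Longrightarrow> f \<in> branches Q \<Longrightarrow> map f [0..<length t] = t \<Longrightarrow>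
        \<forall>\<^sub>\<infinity>k. f k \<in> B \<union> Jt t (map f [0..<k])" by blast
    define N where "N u = (if u \<in> Q \<and> prefix s u then V u else {})" for u
    define J where "J w = N w \<union> (\<Union>t\<in>{t \<in> set (prefixes w). dec t}. Jt t w)" for w
    have "N w \<in> I" for w
      using none ideal_of_finite[of "{}"] unfolding N_def target_def by simp
    then have "J w \<in> I" for w
      unfolding J_def using Jt(1)
      by (intro ideal_of_Un ideal_of_UN finite_subset[OF _ finite_set[of "prefixes w"]]) auto
    moreover have "\<forall>\<^sub>\<infinity>k. f k \<in> B \<union> J (map f [0..<k])"
      if f: "f \<in> branches Q" "map f [0..<length s] = s" for f
    proof (cases "\<forall>k\<ge>length s. f k \<in> B \<union> N (map f [0..<k])")
      case True
      then show ?thesis unfolding MOST_nat_le J_def by blast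
    next
      case False
      then obtain k where k: "length s \<le> k" "f k \<notin> B" "f k \<notin> N (map f [0..<k])" by blast
      let ?t = "map f [0..<Suc k]"
      have fQ: "map f [0..<j] \<in> Q" for j using f(1) unfolding branches_def by blast
      have pre: "prefix (map f [0..<i]) (map f [0..<j])" if "i \<le> j" for i j
        using that by (metis le_add_diff_inverse map_append prefixI upt_add_eq_append zero_le)
      have "prefix s (map f [0..<k])" using pre[OF k(1)] f(2) by simp
      moreover have "f k \<in> suc_set Q (map f [0..<k])" using fQ[of "Suc k"] unfolding suc_set_def by simp
      ultimately have "dec ?t" using k fQ[of k] unfolding N_def V_def by simp
      then have "\<forall>\<^sub>\<infinity>j. f j \<in> B \<union> Jt ?t (map f [0..<j])" using Jt(2) f(1) by simp
      moreover have "\<forall>\<^sub>\<infinity>j. Suc k \<le> j" unfolding MOST_nat_le by blast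
      ultimately show ?thesis
      proof eventually_elim
        case (elim j)
        then have "?t \<in> set (prefixes (map f [0..<j]))" using pre[of "Suc k" j] by simp
        then show ?case using elim \<open>dec ?t\<close> unfolding J_def by blast
      qed
    qed
    ultimately have "dec s" unfolding dec_def by blast
    then show False using that by blast
  qed
  \<comment> \<open>Targets of least length make the induction below terminate: after a step towards
    \<open>tg w\<close>, the new node's target is no longer than the old one.\<close>
  define dist where "dist s = (LEAST m. \<exists>u. target s u \<and> length u = m)" for s
  define tg where "tg s = (SOME u. target s u \<and> length u = dist s)" for s
  have tg: "target s (tg s)" "length (tg s) = dist s" if "\<not> dec s" for s
  proof -
    have "\<exists>u. target s u \<and> length u = dist s"
      unfolding dist_def by (rule LeastI_ex) (use ex_target[OF that] in simp)
    then have "target s (tg s) \<and> length (tg s) = dist s" unfolding tg_def by (rule someI_ex)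
    then show "target s (tg s)" "length (tg s) = dist s" by simp_all
  qed
  have dist_le: "dist s \<le> length u" if "target s u" for s u
    unfolding dist_def using that by (intro Least_le) blast
  define ok where "ok u n \<longleftrightarrow> \<not> dec (u @ [n]) \<and> (n \<notin> B \<or> (tg u \<noteq> u \<and> n = tg u ! length u))" for u n
  define Q' where "Q' = {w \<in> Q. \<forall>i<length w. ok (take i w) (w ! i)}"
  have nil': "[] \<in> Q'" unfolding Q'_def using nil by simp
  have suc: "u @ [n] \<in> Q' \<longleftrightarrow> u @ [n] \<in> Q \<and> ok u n" if "u \<in> Q'" for u n
    using that unfolding Q'_def by (auto simp: nth_append less_Suc_eq)
  have "seq_tree Q'"
    unfolding seq_tree_def
  proof (intro conjI ballI allI impI)
    show "Q' \<noteq> {}" using nil' by blast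
    fix t s assume t: "t \<in> Q'" "prefix s t"
    then have "s \<in> Q" using tree unfolding Q'_def seq_tree_def by blast
    moreover have "ok (take i s) (s ! i)" if "i < length s" for i
    proof -
      have "take i s = take i t" "s ! i = t ! i" "i < length t"
        using t(2) that prefix_nth[OF t(2) that] by (auto simp: prefix_def)
      then show ?thesis using t(1) unfolding Q'_def by simp
    qed
    ultimately show "s \<in> Q'" unfolding Q'_def by blast
  qed
  have root: "\<not> dec []" using nf unfolding dec_def forces_def by simp
  have undec: "\<not> dec w" if "w \<in> Q'" for w
  proof (cases w rule: rev_cases)
    case Nil
    then show ?thesis using root by simp
  next
    case (snoc u n)
    then have "ok u n" using that unfolding Q'_def by (auto simp: nth_append)
    then show ?thesis using snoc unfolding ok_def by simp
  qed
  \<comment> \<open>Induction on the distance to the target. Nodes on the way are undecided, since a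
    decided node has only decided extensions and would make \<open>V\<close> empty at the
    target.\<close>
  have ext: "\<exists>u\<in>Q'. prefix w u \<and> suc_set Q' u \<notin> I" if "w \<in> Q'" for w
    using that
  proof (induction "length (tg w) - length w" arbitrary: w rule: less_induct)
    case less
    have nd: "\<not> dec w" using undec[OF less.prems] .
    note t = tg(1)[OF nd, unfolded target_def]
    show ?case
    proof (cases "tg w = w")
      case True
      then have "V w \<notin> I" using t by simp
      moreover have "V w \<subseteq> suc_set Q' w"
        using suc[OF less.prems] unfolding V_def suc_set_def ok_def by blast
      ultimately show ?thesis using less.prems ideal_of_subset by blast
    next
      case False
      define w' where "w' = w @ [tg w ! length w]"
      have len: "length w < length (tg w)"
        using False t by (intro prefix_length_less) (auto simp: strict_prefix_def)
      have w'p: "prefix w' (tg w)"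
        unfolding w'_def using t len by (metis append_one_prefix)
      have "w' \<in> Q" using w'p t tree unfolding seq_tree_def by blast
      have "\<not> dec w'"
      proof
        assume "dec w'"
        then have "dec (tg w @ [n])" for n using dec_prefix w'p by (meson prefix_order.trans prefixI)
        then have "V (tg w) = {}" unfolding V_def by blast
        then show False using t ideal_of_finite by simp
      qed
      then have "w' \<in> Q'"
        using suc[OF less.prems] \<open>w' \<in> Q\<close> False unfolding w'_def ok_def by blast
      have "target w' (tg w)" unfolding target_def using t w'p by blast
      then have "length (tg w') \<le> length (tg w)" using dist_le tg(2)[OF \<open>\<not> dec w'\<close>] by simp
      then have "length (tg w') - length w' < length (tg w) - length w" using len unfolding w'_def by simp
      from less.hyps[OF this \<open>w' \<in> Q'\<close>] obtain u where "u \<in> Q'" "prefix w' u" "suc_set Q' u \<notin> I" by blast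
      moreover have "prefix w w'" unfolding w'_def by simp
      ultimately show ?thesis using prefix_order.trans by blast
    qed
  qed
  \<comment> \<open>The only possible step into \<open>B\<close> at a node is the one towards its
    target, so singletons suffice as errors.\<close>
  have "forces Q' (- B)"
    unfolding forces_def
  proof (intro exI[of _ "\<lambda>u. {tg u ! length u}"] conjI allI ballI)
    show "{tg u ! length u} \<in> I" for u by (simp add: ideal_of_finite)
    fix f assume f: "f \<in> branches Q'"
    have "f k \<in> - B \<union> {tg (map f [0..<k]) ! length (map f [0..<k])}" for k
    proof -
      have "map f [0..<k] \<in> Q'" "map f [0..<k] @ [f k] \<in> Q'"
        using f unfolding branches_def by (blast, metis (mono_tags, lifting) mem_Collect_eq map_append
            list.simps(8,9) upt_Suc_append zero_le)
      then have "ok (map f [0..<k]) (f k)" using suc by blast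
      then show ?thesis unfolding ok_def by blast
    qed
    then show "\<forall>\<^sub>\<infinity>k. f k \<in> - B \<union> {tg (map f [0..<k]) ! length (map f [0..<k])}" by simp
  qed
  moreover have "Q' \<subseteq> Q" unfolding Q'_def by blast
  moreover have "positive_tree Q'" unfolding positive_tree_def using \<open>seq_tree Q'\<close> ext by blast
  ultimately show ?thesis using that by blast
qed

section \<open>Cutting positive trees in two\<close>

definition tree_cut :: "nat list set \<Rightarrow> 'k" where
  "tree_cut Q = (SOME a. a \<in> D \<and> (\<not> forces Q (S a) \<and> \<not> forces Q (- S a)) \<and>
     (\<forall>b\<in>D. b \<sqsubset> a \<longrightarrow> \<not> (\<not> forces Q (S b) \<and> \<not> forces Q (- S b))))"

definition tree_dir :: "nat list set \<Rightarrow> 'k \<Rightarrow> bool" where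
  "tree_dir Q b \<longleftrightarrow> forces Q (S b)"

text \<open>A tree has only countably many nodes, so one index splits all its positive successor
  sets at once. Both sides are then densely positive, and neither complement is forced; hence a
  least undecided index exists.\<close>

lemma
  assumes Q: "positive_tree Q"
  shows tree_cut_in: "tree_cut Q \<in> D" and not_forces_tree_cut: "\<not> forces Q (side (tree_cut Q) i)"
    and forces_tree_dir: "b \<in> D \<Longrightarrow> b \<sqsubset> tree_cut Q \<Longrightarrow> forces Q (side b (tree_dir Q b))"
proof -
  define G where "G = {u \<in> Q. suc_set Q u \<notin> I}"
  have tree: "seq_tree Q" using Q unfolding positive_tree_def by blast
  have "G \<noteq> {}" using Q unfolding positive_tree_def seq_tree_def G_def by blast
  have G: "from_nat_into G n \<in> G" for n by (rule from_nat_into[OF \<open>G \<noteq> {}\<close>])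
  obtain a where a: "a \<in> D" "\<forall>n. suc_set Q (from_nat_into G n) \<inter> S a \<notin> I \<and> suc_set Q (from_nat_into G n) - S a \<notin> I"
    using positive_split[OF ad, of "\<lambda>n. suc_set Q (from_nat_into G n)"] G unfolding G_def by blast
  have *: "suc_set Q u \<inter> S a \<notin> I \<and> suc_set Q u \<inter> - S a \<notin> I" if "u \<in> Q" "suc_set Q u \<notin> I" for u
  proof -
    have "countable G" "u \<in> G" using that by (simp_all add: G_def)
    from from_nat_into_surj[OF this] obtain n where "from_nat_into G n = u" ..
    then show ?thesis using a(2) by (metis Diff_eq)
  qed
  have "\<forall>s\<in>Q. \<exists>u\<in>Q. prefix s u \<and> suc_set Q u \<inter> S a \<notin> I" "\<forall>s\<in>Q. \<exists>u\<in>Q. prefix s u \<and> suc_set Q u \<inter> - S a \<notin> I"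
    using Q * unfolding positive_tree_def by blast+
  then have "\<not> forces Q (S a) \<and> \<not> forces Q (- S a)"
    using not_forces_Compl[OF tree, of "S a"] not_forces_Compl[OF tree, of "- S a"] by simp
  from lt_least[of a "\<lambda>a. \<not> forces Q (S a) \<and> \<not> forces Q (- S a)", OF a(1) this]
  have *: "tree_cut Q \<in> D \<and> (\<not> forces Q (S (tree_cut Q)) \<and> \<not> forces Q (- S (tree_cut Q))) \<and>
     (\<forall>b\<in>D. b \<sqsubset> tree_cut Q \<longrightarrow> \<not> (\<not> forces Q (S b) \<and> \<not> forces Q (- S b)))"
    unfolding tree_cut_def Bex_def by (rule someI_ex)
  then show "tree_cut Q \<in> D" "\<not> forces Q (side (tree_cut Q) i)" by (auto simp: side_def)
  show "forces Q (side b (tree_dir Q b))" if "b \<in> D" "b \<sqsubset> tree_cut Q"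
    using * that by (auto simp: side_def tree_dir_def)
qed

lemma forces_side_dir:
  assumes "positive_tree Q" "forces Q (side b i)"
  shows "tree_dir Q b = i"
  using forces_not_Compl[OF assms] assms(2) by (cases i) (auto simp: side_def tree_dir_def)

text \<open>Forced sides are inherited by subtrees, so decisions persist and the cut can only move
  up.\<close>

lemma forced_below_tree_cut:
  assumes Q: "positive_tree Q" and Q': "positive_tree Q'" "Q' \<subseteq> Q"
  shows tree_cut_mono: "tree_cut Q = tree_cut Q' \<or> tree_cut Q \<sqsubset> tree_cut Q'"
    and tree_dir_mono: "b \<in> D \<Longrightarrow> b \<sqsubset> tree_cut Q \<Longrightarrow> tree_dir Q' b = tree_dir Q b"
proof -
  have *: "forces Q' (side b (tree_dir Q b))" if "b \<in> D" "b \<sqsubset> tree_cut Q" for b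
    using forces_subtree[OF forces_tree_dir[OF Q that] Q'(2)] .
  then have "\<not> tree_cut Q' \<sqsubset> tree_cut Q"
    using not_forces_tree_cut[OF Q'(1)] tree_cut_in[OF Q'(1)] by blast
  then show "tree_cut Q = tree_cut Q' \<or> tree_cut Q \<sqsubset> tree_cut Q'"
    using lt_total[OF tree_cut_in[OF Q] tree_cut_in[OF Q'(1)]] by blast
  show "tree_dir Q' b = tree_dir Q b" if "b \<in> D" "b \<sqsubset> tree_cut Q"
    using forces_side_dir[OF Q'(1) *[OF that]] .
qed

definition tree_half :: "nat list set \<Rightarrow> bool \<Rightarrow> nat list set" where
  "tree_half Q i = (SOME Q'. Q' \<subseteq> Q \<and> positive_tree Q' \<and> forces Q' (side (tree_cut Q) i))"

text \<open>At the cut the opposite side is not forced, so \<open>positive_subtree_avoiding\<close>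
  yields a positive subtree forcing side \<open>i\<close>, the choice made in
  \<open>tree_half\<close>. The old cut is decided there, which pushes the new cut higher.\<close>

lemma
  assumes Q: "positive_tree Q"
  shows tree_half_subset: "tree_half Q i \<subseteq> Q" and tree_half_positive: "positive_tree (tree_half Q i)"
    and tree_cut_half: "tree_cut Q \<sqsubset> tree_cut (tree_half Q i)"
    and tree_dir_half: "tree_dir (tree_half Q i) (tree_cut Q) = i"
proof -
  have "\<not> forces Q (side (tree_cut Q) (\<not> i))" by (rule not_forces_tree_cut[OF Q])
  then have "\<exists>Q'. Q' \<subseteq> Q \<and> positive_tree Q' \<and> forces Q' (side (tree_cut Q) i)"
    using positive_subtree_avoiding[OF Q] by (metis side_Not double_complement)
  from someI_ex[OF this]
  have *: "tree_half Q i \<subseteq> Q" "positive_tree (tree_half Q i)" "forces (tree_half Q i) (side (tree_cut Q) i)"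
    unfolding tree_half_def by blast+
  show "tree_half Q i \<subseteq> Q" "positive_tree (tree_half Q i)" using * by blast+
  show "tree_cut Q \<sqsubset> tree_cut (tree_half Q i)"
    using tree_cut_mono[OF Q *(2,1)] *(3) not_forces_tree_cut[OF *(2)] by metis
  show "tree_dir (tree_half Q i) (tree_cut Q) = i" using forces_side_dir[OF *(2,3)] .
qed

section \<open>Subtrees above a node and the numbers picked there\<close>

definition tree_at :: "nat list set \<Rightarrow> nat list \<Rightarrow> nat list set" where
  "tree_at Q t = {w \<in> Q. prefix w t \<or> prefix t w}"

lemma positive_tree_at:
  assumes Q: "positive_tree Q" and t: "t \<in> Q"
  shows "positive_tree (tree_at Q t)"
  unfolding positive_tree_def
proof
  show "seq_tree (tree_at Q t)"
    unfolding seq_tree_def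
  proof (intro conjI ballI allI impI)
    show "tree_at Q t \<noteq> {}" using t unfolding tree_at_def by auto
    fix w s assume "w \<in> tree_at Q t" "prefix s w"
    then show "s \<in> tree_at Q t"
      using Q unfolding tree_at_def positive_tree_def seq_tree_def
      by (auto intro: prefix_order.trans dest: prefix_same_cases)
  qed
  show "\<forall>s\<in>tree_at Q t. \<exists>u\<in>tree_at Q t. prefix s u \<and> suc_set (tree_at Q t) u \<notin> I"
  proof
    fix s assume s: "s \<in> tree_at Q t"
    define s' where "s' = (if prefix s t then t else s)"
    have s': "s' \<in> Q" "prefix s s'" "prefix t s'" using s t unfolding s'_def tree_at_def by auto
    then obtain u where u: "u \<in> Q" "prefix s' u" "suc_set Q u \<notin> I"
      using Q unfolding positive_tree_def by blast
    have tu: "prefix t u" using s'(3) u(2) prefix_order.trans by blast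
    then have "suc_set (tree_at Q t) u = suc_set Q u" unfolding suc_set_def tree_at_def by auto
    then show "\<exists>u\<in>tree_at Q t. prefix s u \<and> suc_set (tree_at Q t) u \<notin> I"
      using u s'(2) tu prefix_order.trans unfolding tree_at_def by (intro bexI[of _ u]) auto
  qed
qed

text \<open>A positive tree has arbitrarily long nodes, and inside \<open>tree_at Q0 t\<close> the
  long ones pass through \<open>t\<close>. Halving above a node therefore keeps that node.\<close>

lemma stem_in_positive_tree:
  assumes Q: "positive_tree Q" and sub: "Q \<subseteq> tree_at Q0 t"
  shows "t \<in> Q"
proof -
  have "\<exists>w\<in>Q. m \<le> length w" for m
  proof (induction m)
    case 0
    then show ?case using Q unfolding positive_tree_def seq_tree_def by auto
  next
    case (Suc m)
    then obtain w where "w \<in> Q" "m \<le> length w" by blast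
    then obtain u where u: "u \<in> Q" "prefix w u" "suc_set Q u \<notin> I"
      using Q unfolding positive_tree_def by blast
    then obtain n where "u @ [n] \<in> Q"
      using not_ideal_of_infinite[OF u(3)] infinite_imp_nonempty unfolding suc_set_def by blast
    moreover have "Suc m \<le> length (u @ [n])" using \<open>m \<le> length w\<close> prefix_length_le[OF u(2)] by simp
    ultimately show ?case by blast
  qed
  then obtain w where w: "w \<in> Q" "length t \<le> length w" by blast
  then have "prefix w t \<or> prefix t w" using sub unfolding tree_at_def by blast
  then have "prefix t w" using w(2) by (auto simp: prefix_def)
  then show ?thesis using Q w unfolding positive_tree_def seq_tree_def by blast
qed

lemma infinite_subset_almost_disjoint:
  assumes "X \<notin> I"
  shows "\<exists>Z. Z \<subseteq> X \<and> infinite Z \<and> (\<forall>A\<in>fst ` E. finite (Z \<inter> A))"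
proof (rule fresh[OF assms])
  fix W :: "(nat set \<times> 'k \<times> ('k \<Rightarrow> bool)) set"
  assume W: "infinite W" "\<forall>Z\<in>fst ` W. Z \<subseteq> X \<and> infinite Z \<and> (\<forall>A\<in>fst ` E. finite (Z \<inter> A))"
  then obtain w where "w \<in> W" using infinite_imp_nonempty by blast
  then show ?thesis using W(2) by (intro exI[of _ "fst w"]) simp
qed

definition splitting_node :: "nat list set \<Rightarrow> nat list \<Rightarrow> nat list" where
  "splitting_node Q s = (SOME u. u \<in> Q \<and> prefix s u \<and> suc_set Q u \<notin> I)"

definition picks :: "nat list set \<Rightarrow> nat list \<Rightarrow> nat set" where
  "picks Q s = (SOME Z. Z \<subseteq> suc_set Q (splitting_node Q s) \<and> infinite Z \<and> (\<forall>A\<in>fst ` E. finite (Z \<inter> A)))"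

lemma
  assumes "positive_tree Q" "s \<in> Q"
  shows splitting_node: "splitting_node Q s \<in> Q" "prefix s (splitting_node Q s)"
    and picks: "picks Q s \<subseteq> suc_set Q (splitting_node Q s)" "infinite (picks Q s)"
      "A \<in> fst ` E \<Longrightarrow> finite (picks Q s \<inter> A)"
proof -
  have "\<exists>u. u \<in> Q \<and> prefix s u \<and> suc_set Q u \<notin> I"
    using assms unfolding positive_tree_def by blast
  from someI_ex[OF this]
  have *: "splitting_node Q s \<in> Q \<and> prefix s (splitting_node Q s) \<and> suc_set Q (splitting_node Q s) \<notin> I"
    unfolding splitting_node_def .
  then show "splitting_node Q s \<in> Q" "prefix s (splitting_node Q s)" by blast+
  from * have "\<exists>Z. Z \<subseteq> suc_set Q (splitting_node Q s) \<and> infinite Z \<and> (\<forall>A\<in>fst ` E. finite (Z \<inter> A))"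
    using infinite_subset_almost_disjoint by blast
  from someI_ex[OF this]
  have "picks Q s \<subseteq> suc_set Q (splitting_node Q s) \<and> infinite (picks Q s) \<and> (\<forall>A\<in>fst ` E. finite (picks Q s \<inter> A))"
    unfolding picks_def .
  then show "picks Q s \<subseteq> suc_set Q (splitting_node Q s)" "infinite (picks Q s)"
      "A \<in> fst ` E \<Longrightarrow> finite (picks Q s \<inter> A)" by blast+
qed

fun refine :: "nat list set \<times> nat list \<Rightarrow> nat \<times> bool \<Rightarrow> nat list set \<times> nat list" where
  "refine (Q, s) (n, i) = (if n \<in> picks Q s
     then (tree_half (tree_at Q (splitting_node Q s @ [n])) i, splitting_node Q s @ [n]) else (Q, s))"

lemma refine:
  assumes Q: "positive_tree Q" "s \<in> Q" and r: "refine (Q, s) (n, i) = (Q', s')"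
  shows "positive_tree Q' \<and> s' \<in> Q' \<and> Q' \<subseteq> Q"
proof (cases "n \<in> picks Q s")
  case True
  let ?t = "splitting_node Q s @ [n]"
  have "?t \<in> Q" using picks(1)[OF Q] True unfolding suc_set_def by blast
  then have C: "positive_tree (tree_at Q ?t)" by (rule positive_tree_at[OF Q(1)])
  have Q': "Q' = tree_half (tree_at Q ?t) i" "s' = ?t" using r True by auto
  have "Q' \<subseteq> tree_at Q ?t" "positive_tree Q'"
    unfolding Q' using tree_half_subset[OF C] tree_half_positive[OF C] by auto
  moreover have "tree_at Q ?t \<subseteq> Q" unfolding tree_at_def by blast
  ultimately show ?thesis using stem_in_positive_tree Q'(2) by blast
next
  case False
  then show ?thesis using r Q by auto
qed

text \<open>
  Every bit string \<open>x\<close> yields a branch whose range follows its own branch of the binary tree of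
  nodes; a member of the family that could cover the range must have a node extending that branch,
  so fewer than continuum many members cannot cover all these ranges.
\<close>

theorem positive_branch:
  assumes T: "seq_tree T" and br: "branching (positive_sets (fst ` E)) T"
  obtains f where "f \<in> branches T" "range f \<notin> I"
proof -
  have posT: "positive_tree T"
    using T br unfolding positive_tree_def branching_def positive_sets_def by blast
  have nil: "[] \<in> T" using T unfolding seq_tree_def by (metis Nil_prefix ex_in_conv)
  define st where "st l = foldl refine (T, []) l" for l
  define QQ where "QQ l = fst (st l)" for l
  define U where "U l = splitting_node (QQ l) (snd (st l))" for l
  define Z where "Z l = picks (QQ l) (snd (st l))" for l
  have st_snoc: "st (l @ [c]) = refine (QQ l, snd (st l)) c" for l c
    by (simp add: st_def QQ_def)
  have inv: "positive_tree (QQ l) \<and> snd (st l) \<in> QQ l" for l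
  proof (induction l rule: rev_induct)
    case Nil
    then show ?case using posT nil by (simp add: st_def QQ_def)
  next
    case (snoc c l)
    then show ?case
      using refine[of "QQ l" "snd (st l)" "fst c" "snd c" "QQ (l @ [c])" "snd (st (l @ [c]))"]
        st_snoc[of l c] by (simp add: QQ_def)
  qed
  then have pos: "positive_tree (QQ l)" and sQ: "snd (st l) \<in> QQ l" for l by blast+
  have QQ_snoc: "QQ (l @ [c]) \<subseteq> QQ l" for l c
    using refine[OF pos sQ, of l "fst c" "snd c" "QQ (l @ [c])" "snd (st (l @ [c]))"]
      st_snoc[of l c] by (simp add: QQ_def)
  have QQ_mono: "QQ (l @ l') \<subseteq> QQ l" for l l'
  proof (induction l' rule: rev_induct)
    case (snoc c l')
    then show ?case using QQ_snoc[of "l @ l'" c] by simp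
  qed simp
  have QQT: "QQ l \<subseteq> T" for l using QQ_mono[of "[]" l] by (simp add: st_def QQ_def)
  have st_pick: "st (l @ [(n, i)]) = (tree_half (tree_at (QQ l) (U l @ [n])) i, U l @ [n])" if "n \<in> Z l" for l n i
    using st_snoc[of l "(n, i)"] that by (simp add: Z_def U_def)
  have UQ: "U l \<in> QQ l" for l unfolding U_def using splitting_node(1)[OF pos sQ] .
  have UT: "\<forall>l. U l \<in> T" using UQ QQT by blast
  have step: "\<forall>l. \<forall>n\<in>Z l. \<forall>b. prefix (U l @ [n]) (U (l @ [(n, b)]))"
  proof (intro allI ballI)
    fix l n b assume "n \<in> Z l"
    then have "snd (st (l @ [(n, b)])) = U l @ [n]" by (simp add: st_pick)
    then show "prefix (U l @ [n]) (U (l @ [(n, b)]))"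
      using splitting_node(2)[OF pos sQ, of "l @ [(n, b)]"] unfolding U_def by simp
  qed
  have infZ: "\<forall>l. infinite (Z l)" unfolding Z_def using picks(2)[OF pos sQ] by blast
  have adZ: "finite (Z l \<inter> A)" if "A \<in> fst ` E" for l A
    unfolding Z_def using picks(3)[OF pos sQ that] .
  define a where "a l = tree_cut (QQ l)" for l
  define y where "y l = tree_dir (QQ l)" for l
  have aD: "a l \<in> D" for l unfolding a_def by (rule tree_cut_in[OF pos])
  define J where "J l c = (SOME J. (\<forall>u. J u \<in> I) \<and>
      (\<forall>f\<in>branches (QQ l). \<forall>\<^sub>\<infinity>k. f k \<in> side c (y l c) \<union> J (map f [0..<k])))" for l c
  have "(\<forall>u. J l c u \<in> I) \<and>
      (\<forall>f\<in>branches (QQ l). \<forall>\<^sub>\<infinity>k. f k \<in> side c (y l c) \<union> J l c (map f [0..<k]))"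
    if "c \<in> D" "c \<sqsubset> a l" for l c
    using someI_ex[OF forces_tree_dir[OF pos, unfolded forces_def, of c l]] that
    unfolding J_def a_def y_def by blast
  then have J: "\<And>l c u. c \<in> D \<Longrightarrow> c \<sqsubset> a l \<Longrightarrow> J l c u \<in> I"
    "\<And>l c f. c \<in> D \<Longrightarrow> c \<sqsubset> a l \<Longrightarrow> f \<in> branches (QQ l) \<Longrightarrow>
       \<forall>\<^sub>\<infinity>k. f k \<in> side c (y l c) \<union> J l c (map f [0..<k])" by blast+
  define P where "P l = {A. \<exists>b' y'. (A, b', y') \<in> E \<and> b' \<sqsubset> a l \<and> agree b' y' (y l)}" for l
  \<comment> \<open>Two kinds of obstacles: errors of the forced sides at \<open>(l, c)\<close>, and
    members attached to proper initial segments of the node of \<open>QQ l\<close>. There are few of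
    them, since the countably many cuts \<open>a l\<close> have a common bound
    \<open>m\<close>.\<close>
  define \<J> where "\<J> = (\<Union>l. (\<lambda>c. Inl (l, c)) ` {c \<in> D. c \<sqsubset> a l} \<union> Inr ` P l)"
  obtain m where m: "m \<in> D" "\<And>l. a l \<sqsubset> m"
    using countable_bounded[of "range a"] aD by (metis countable_image countableI_type image_subsetI rangeI)
  have below_m: "{c \<in> D. c \<sqsubset> a l} \<subseteq> {c \<in> D. c \<sqsubset> m}" for l using m(2) lt_trans by blast
  have lists: "small (UNIV :: (nat \<times> bool) list set)" by (rule small_countable) simp
  have "small (\<Union>l. (\<lambda>c. Inl (l, c)) ` {c \<in> D. c \<sqsubset> a l} :: (((nat \<times> bool) list \<times> 'k) + nat set) set)"
    by (rule small_UN[OF lists small_below[OF m(1)]])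
      (rule ordLeq_transitive[OF card_of_image card_of_mono1[OF below_m]])
  moreover have "small (\<Union>l. Inr ` P l :: (((nat \<times> bool) list \<times> 'k) + nat set) set)"
  proof (rule small_UN[OF lists small_below[OF m(1)]])
    fix l
    have "|P l| \<le>o |{c \<in> D. c \<sqsubset> a l}|" unfolding P_def by (rule card_below_node[OF aD])
    then show "|Inr ` P l :: (((nat \<times> bool) list \<times> 'k) + nat set) set| \<le>o |{c \<in> D. c \<sqsubset> m}|"
      using below_m[of l] by (meson card_of_image card_of_mono1 ordLeq_transitive)
  qed
  ultimately have "small \<J>"
    unfolding \<J>_def UN_Un_distrib by (rule small_Un)
  \<comment> \<open>Both intersections with \<open>Z l\<close> are finite for relevant indices, so
    numbers above the maximum avoid the error set or the member.\<close>
  define H where "H j l = (case j of Inl lc \<Rightarrow> Max (J (fst lc) (snd lc) (U l) \<inter> Z l) | Inr A \<Rightarrow> Max (Z l \<inter> A))" for j l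
  obtain v where v: "\<forall>l. v l \<in> Z l" "\<forall>l. length l < v l"
    "\<forall>x K. finite K \<and> K \<subseteq> \<J> \<longrightarrow> (\<exists>\<^sub>\<infinity>k. \<forall>j\<in>K. H j (path v x k) < v (path v x k))"
    using scheme_selector[OF \<open>small \<J>\<close> infZ, of H] by blast
  have path_append: "\<exists>l'. path v x k = path v x k0 @ l'" if "k0 \<le> k" for x k0 k
    using that by (induction k rule: dec_induct) auto
  \<comment> \<open>The two halves disagree at the cut of the tree they come from, so the bit string
    is recorded in the nodes.\<close>
  have split: "\<exists>c\<in>D. \<forall>i. c \<sqsubset> a (l @ [(n, i)]) \<and> y (l @ [(n, i)]) c = i" if n: "n \<in> Z l" for l n
  proof -
    have "U l @ [n] \<in> QQ l" using picks(1)[OF pos sQ] n unfolding Z_def U_def suc_set_def by blast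
    then have C: "positive_tree (tree_at (QQ l) (U l @ [n]))" by (rule positive_tree_at[OF pos])
    have "QQ (l @ [(n, i)]) = tree_half (tree_at (QQ l) (U l @ [n])) i" for i
      unfolding QQ_def using st_pick[OF n] by (simp add: QQ_def)
    then show ?thesis
      using tree_cut_in[OF C] tree_cut_half[OF C] tree_dir_half[OF C] unfolding a_def y_def
      by (intro bexI[of _ "tree_cut (tree_at (QQ l) (U l @ [n]))"]) auto
  qed
  \<comment> \<open>The node of \<open>e\<close> equals or extends every node along the path of
    \<open>x\<close>. Paths of different strings disagree below the heights reached, so
    \<open>e\<close> catches at most one string.\<close>
  define caught where "caught x e \<longleftrightarrow> e \<in> E \<and> (\<forall>k. (a (path v x k) = fst (snd e) \<or> a (path v x k) \<sqsubset> fst (snd e)) \<and>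
     agree (a (path v x k)) (snd (snd e)) (y (path v x k)))" for x e
  have caught_unique: "x = x'" if "caught x e" "caught x' e" for x x' e
  proof (rule ccontr)
    assume "x \<noteq> x'"
    define k where "k = (LEAST k. x k \<noteq> x' k)"
    have k: "x k \<noteq> x' k" "\<And>i. i < k \<Longrightarrow> x i = x' i"
      using \<open>x \<noteq> x'\<close> LeastI_ex[of "\<lambda>k. x k \<noteq> x' k"] not_less_Least unfolding k_def by blast+
    then have eq: "path v x' k = path v x k" by (intro path_cong) simp
    obtain c where c: "c \<in> D" "\<And>i. c \<sqsubset> a (path v x k @ [(v (path v x k), i)])"
      "\<And>i. y (path v x k @ [(v (path v x k), i)]) c = i"
      using split[of "v (path v x k)" "path v x k"] v(1) by blast
    have "agree (a (path v x (Suc k))) (snd (snd e)) (y (path v x (Suc k)))"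
      "agree (a (path v x' (Suc k))) (snd (snd e)) (y (path v x' (Suc k)))"
      using that unfolding caught_def by blast+
    then have "snd (snd e) c = x k" "snd (snd e) c = x' k"
      using c unfolding agree_def by (auto simp: eq)
    then show False using k(1) by blast
  qed
  have "\<exists>x. \<forall>e. \<not> caught x e"
  proof (rule ccontr)
    assume "\<not> ?thesis"
    then obtain \<epsilon> where \<epsilon>: "\<And>x. caught x (\<epsilon> x)" by metis
    have "inj \<epsilon>" using \<epsilon> caught_unique by (metis injI)
    moreover have "range \<epsilon> \<subseteq> E" using \<epsilon> unfolding caught_def by blast
    ultimately have "|UNIV :: (nat \<Rightarrow> bool) set| \<le>o |E|" using card_of_ordLeq by metis
    then show False using card_E not_ordLess_ordLeq by blast
  qed
  then obtain x where x: "\<And>e. \<not> caught x e" by blast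
  define p where "p = path v x"
  obtain f where f: "f \<in> branches T" "\<forall>k. map f [0..<length (U (p k))] = U (p k)"
      "\<forall>k. f (length (U (p k))) = v (p k)"
    unfolding p_def using scheme_branch[OF T UT step v(1), of x] by metis
  have lenU: "k \<le> length (U (p k))" for k unfolding p_def using scheme_prefix(3)[OF step v(1)] .
  have fQ: "f \<in> branches (QQ (p k0))" for k0
  proof -
    have "map f [0..<n] \<in> QQ (p k0)" for n
    proof -
      let ?k = "max n k0"
      obtain l' where "p ?k = p k0 @ l'" using path_append[of k0 ?k x] unfolding p_def by auto
      then have "U (p ?k) \<in> QQ (p k0)" using UQ[of "p ?k"] QQ_mono[of "p k0" l'] by auto
      moreover have "prefix (map f [0..<n]) (map f [0..<length (U (p ?k))])"
      proof -
        have "n \<le> length (U (p ?k))" using lenU[of ?k] by simp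
        then show ?thesis by (metis le_add_diff_inverse map_append prefixI upt_add_eq_append zero_le)
      qed
      ultimately show ?thesis using f(2) pos[of "p k0"] unfolding positive_tree_def seq_tree_def by metis
    qed
    then show ?thesis unfolding branches_def by blast
  qed
  \<comment> \<open>As no triple catches \<open>x\<close>, one of two cases holds at some stage
    \<open>k0\<close>. Either the nodes disagree at some \<open>c\<close>, so that \<open>A\<close>
    lies almost in one side of \<open>S c\<close> and the branch, up to errors, eventually in the
    other; or the node of \<open>A\<close> is a proper initial segment and \<open>A\<close> is
    itself an obstacle in \<open>\<J>\<close>.\<close>
  have control: "\<exists>j\<in>\<J>. \<forall>\<^sub>\<infinity>k. H j (p k) < v (p k) \<longrightarrow> v (p k) \<notin> A" if "A \<in> fst ` E" for A
  proof -
    obtain b \<eta> where e: "(A, b, \<eta>) \<in> E" using \<open>A \<in> fst ` E\<close> by auto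
    have bD: "b \<in> D" using e coherent unfolding coherent_def by blast
    obtain k0 where k0: "\<not> ((a (p k0) = b \<or> a (p k0) \<sqsubset> b) \<and> agree (a (p k0)) \<eta> (y (p k0)))"
      using x[of "(A, b, \<eta>)"] e unfolding caught_def p_def by auto
    show ?thesis
    proof (cases "\<exists>c\<in>D. c \<sqsubset> a (p k0) \<and> c \<sqsubset> b \<and> \<eta> c \<noteq> y (p k0) c")
      case True
      then obtain c where c: "c \<in> D" "c \<sqsubset> a (p k0)" "c \<sqsubset> b" "y (p k0) c = (\<not> \<eta> c)" by blast
      let ?j = "Inl (p k0, c) :: ((nat \<times> bool) list \<times> 'k) + nat set"
      have "finite (A - side c (\<eta> c))" using e coherent c unfolding coherent_def by blast
      then obtain M where M: "\<forall>n\<in>A - side c (\<eta> c). n \<le> M"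
        unfolding finite_nat_set_iff_bounded_le ..
      obtain N where N: "\<And>k. N \<le> k \<Longrightarrow> f k \<in> side c (\<not> \<eta> c) \<union> J (p k0) c (map f [0..<k])"
        using J(2)[OF c(1,2) fQ] c(4) unfolding MOST_nat_le by auto
      have "v (p k) \<notin> A" if k: "M + N \<le> k" "H ?j (p k) < v (p k)" for k
      proof
        assume "v (p k) \<in> A"
        have "finite (J (p k0) c (U (p k)) \<inter> Z (p k))"
          using finite_Int_ideal_of[OF J(1)[OF c(1,2)] adZ] .
        moreover have "Max (J (p k0) c (U (p k)) \<inter> Z (p k)) < v (p k)"
          using k(2) unfolding H_def by simp
        ultimately have "v (p k) \<notin> J (p k0) c (U (p k)) \<inter> Z (p k)" by (meson Max_ge leD)
        then have "v (p k) \<notin> J (p k0) c (U (p k))" using v(1) by blast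
        moreover have "f (length (U (p k))) \<in> side c (\<not> \<eta> c) \<union> J (p k0) c (map f [0..<length (U (p k))])"
          using N lenU[of k] k(1) by simp
        ultimately have "v (p k) \<in> side c (\<not> \<eta> c)" using f(2,3) by auto
        then have "v (p k) \<le> M" using M \<open>v (p k) \<in> A\<close> by (simp add: side_Not)
        moreover have "k < v (p k)" using v(2)[rule_format, of "p k"] unfolding p_def by simp
        ultimately show False using k(1) by simp
      qed
      moreover have "?j \<in> \<J>" using c unfolding \<J>_def by auto
      ultimately show ?thesis unfolding MOST_nat_le by blast
    next
      case False
      have "b \<sqsubset> a (p k0)"
      proof (rule ccontr)
        assume "\<not> b \<sqsubset> a (p k0)"
        then have *: "a (p k0) = b \<or> a (p k0) \<sqsubset> b" using lt_total[OF bD aD] by blast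
        then have "agree (a (p k0)) \<eta> (y (p k0))" using False lt_trans unfolding agree_def by blast
        then show False using k0 * by blast
      qed
      then have "agree b \<eta> (y (p k0))" using False lt_trans unfolding agree_def by blast
      then have "A \<in> P (p k0)" using e \<open>b \<sqsubset> a (p k0)\<close> unfolding P_def by blast
      then have "Inr A \<in> \<J>" unfolding \<J>_def by blast
      moreover have "v (p k) \<notin> A" if "H (Inr A) (p k) < v (p k)" for k
        using Max_ge[OF adZ[OF \<open>A \<in> fst ` E\<close>], of "v (p k)" "p k"] v(1) that unfolding H_def by auto
      ultimately show ?thesis by (intro bexI[of _ "Inr A"]) auto
    qed
  qed
  have "range f \<notin> I"
  proof
    assume "range f \<in> I"
    then obtain F where F: "finite F" "F \<subseteq> fst ` E" "finite (range f - \<Union>F)"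
      unfolding ideal_of_iff by blast
    have "\<forall>A\<in>F. \<exists>j. j \<in> \<J> \<and> (\<forall>\<^sub>\<infinity>k. H j (p k) < v (p k) \<longrightarrow> v (p k) \<notin> A)"
    proof
      fix A assume "A \<in> F"
      then have "A \<in> fst ` E" using F(2) by (rule rev_subsetD)
      then show "\<exists>j. j \<in> \<J> \<and> (\<forall>\<^sub>\<infinity>k. H j (p k) < v (p k) \<longrightarrow> v (p k) \<notin> A)"
        using control unfolding Bex_def by simp
    qed
    from bchoice[OF this] obtain \<kappa> where \<kappa>: "\<And>A. A \<in> F \<Longrightarrow> \<kappa> A \<in> \<J> \<and> (\<forall>\<^sub>\<infinity>k. H (\<kappa> A) (p k) < v (p k) \<longrightarrow> v (p k) \<notin> A)"
      by blast
    have "\<forall>\<^sub>\<infinity>k. \<forall>A\<in>F. H (\<kappa> A) (p k) < v (p k) \<longrightarrow> v (p k) \<notin> A"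
      using \<kappa> F(1) by (simp add: eventually_ball_finite_distrib)
    moreover have "\<exists>\<^sub>\<infinity>k. \<forall>j\<in>\<kappa> ` F. H j (p k) < v (p k)"
      unfolding p_def using v(3) F(1) \<kappa> by blast
    ultimately have "\<exists>\<^sub>\<infinity>k. v (p k) \<in> range f - \<Union>F"
    proof (elim frequently_rev_mp eventually_mono, intro impI)
      fix k assume "\<forall>A\<in>F. H (\<kappa> A) (p k) < v (p k) \<longrightarrow> v (p k) \<notin> A" "\<forall>j\<in>\<kappa> ` F. H j (p k) < v (p k)"
      then have "v (p k) \<notin> \<Union>F" by blast
      moreover have "v (p k) \<in> range f" using f(3) by (metis rangeI)
      ultimately show "v (p k) \<in> range f - \<Union>F" by blast
    qed
    moreover have "k < v (p k)" for k using v(2)[rule_format, of "p k"] unfolding p_def by simp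
    ultimately have "infinite (range f - \<Union>F)" by (rule infinite_of_INFM_unbounded)
    then show False using F(3) by blast
  qed
  then show ?thesis using that f(1) by blast
qed

end

section \<open>The recursion\<close>

text \<open>This provides a second notion of smallness, relative to the continuum, to measure the
  stages of the recursion.\<close>

lemma uncountable_reals: "uncountable_index (UNIV :: (nat \<Rightarrow> bool) set)"
proof
  have "|UNIV :: nat set| <o |UNIV :: nat set set|" using card_of_Pow[of "UNIV :: nat set"] by simp
  moreover have "inj (\<lambda>X n. n \<in> (X :: nat set))" by (auto simp: inj_def fun_eq_iff)
  then have "|UNIV :: nat set set| \<le>o |UNIV :: (nat \<Rightarrow> bool) set|"
    by (meson card_of_ordLeq subset_UNIV)
  ultimately show "|UNIV :: nat set| <o |UNIV :: (nat \<Rightarrow> bool) set|" by (rule ordLess_ordLeq_trans)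
qed

context splitting_index
begin

lemma coherent_if_pairs:
  assumes "\<And>e e'. e \<in> E \<Longrightarrow> e' \<in> E \<Longrightarrow> \<exists>E'. coherent E' \<and> e \<in> E' \<and> e' \<in> E'"
  shows "coherent E"
  unfolding coherent_def
proof (rule conjI; intro allI impI)
  fix A a y assume "(A, a, y) \<in> E"
  then obtain E' where "coherent E'" "(A, a, y) \<in> E'" using assms by blast
  then show "infinite A \<and> a \<in> D \<and> (\<forall>b\<in>D. b \<sqsubset> a \<longrightarrow> finite (A - side b (y b)))"
    unfolding coherent_def by blast
next
  fix A a y A' a' y'
  assume *: "(A, a, y) \<in> E \<and> (A', a', y') \<in> E \<and> (A, a, y) \<noteq> (A', a', y')"
  then obtain E' where "coherent E'" "(A, a, y) \<in> E'" "(A', a', y') \<in> E'" using assms by blast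
  then show "finite (A \<inter> A') \<and> (a = a' \<longrightarrow> \<not> agree a y y')"
    using * unfolding coherent_def by blast
qed

text \<open>Every tree occurs at some stage. If it is positively branching for the family so far,
  infinitely many new members are put inside the range of one of its branches; that range then stays
  positive for the final family. Maximality follows by applying the same property to the tree
  \<open>lists C\<close> of a set \<open>C\<close> almost disjoint from all members.\<close>

theorem plus_Ramsey_MAD: "\<exists>\<A>. MAD \<A> \<and> infinite \<A> \<and> plus_Ramsey \<A>"
proof -
  interpret reals: uncountable_index "UNIV :: (nat \<Rightarrow> bool) set" by (rule uncountable_reals)
  define r where "r = |UNIV :: (nat \<Rightarrow> bool) set|"
  have r: "Card_order r" "Well_order r" "Field r = UNIV"
    unfolding r_def by (simp_all add: card_of_card_order_on card_of_well_order_on Field_card_of)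
  have stage_if: "stage D lt S E" if "coherent E" "reals.small E" for E
    using that by (unfold_locales) (simp_all add: reals.small_def)
  have "stage D lt S {}"
    by (rule stage_if) (auto simp: coherent_def intro: reals.small_countable)
  then obtain E0 where E0: "countable E0" "infinite E0" "coherent E0"
    using stage.fresh[of D lt S "{}" UNIV] by (auto simp: ideal_of_iff)
  \<comment> \<open>Bit strings code all sets of lists, so indexing the recursion by bit strings
    reaches every tree.\<close>
  define tr where "tr i = {l :: nat list. i (to_nat l)}" for i :: "nat \<Rightarrow> bool"
  have tr: "\<exists>i. tr i = T" for T
    by (rule exI[of _ "\<lambda>n. from_nat n \<in> T"]) (simp add: tr_def)
  define Fam where "Fam G i = E0 \<union> (\<Union>j\<in>underS r i. G j)" for G i
  \<comment> \<open>Coherence of the earlier stages appears as a premise, so that every stage has a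
    value; it is established afterwards by well-founded induction.\<close>
  define P where "P G i W \<longleftrightarrow> countable W \<and> (coherent (Fam G i) \<longrightarrow> coherent (Fam G i \<union> W) \<and>
      (seq_tree (tr i) \<and> branching (positive_sets (fst ` Fam G i)) (tr i) \<longrightarrow>
        (\<exists>f\<in>branches (tr i). infinite {e \<in> W. fst e \<subseteq> range f})))" for G i W
  have "wf (r - Id)" using r(2) unfolding well_order_on_def by blast
  then have "\<exists>G. \<forall>i. P G i (G i)"
  proof (rule dependent_wf_choice)
    fix G G' :: "(nat \<Rightarrow> bool) \<Rightarrow> (nat set \<times> 'k \<times> ('k \<Rightarrow> bool)) set" and i W
    assume "\<And>j. (j, i) \<in> r - Id \<Longrightarrow> G j = G' j"
    then have "Fam G i = Fam G' i" unfolding Fam_def underS_def by auto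
    then show "P G i W = P G' i W" unfolding P_def by simp
  next
    fix i and G :: "(nat \<Rightarrow> bool) \<Rightarrow> (nat set \<times> 'k \<times> ('k \<Rightarrow> bool)) set"
    assume IH: "\<And>j. (j, i) \<in> r - Id \<Longrightarrow> P G j (G j)"
    have "countable (G j)" if "j \<in> underS r i" for j
      using IH[of j] that unfolding P_def underS_def by blast
    moreover have "reals.small (underS r i)"
      unfolding reals.small_def r_def[symmetric] by (rule card_of_underS[OF r(1)]) (simp add: r(3))
    ultimately have "reals.small (Fam G i)"
      unfolding Fam_def
      using reals.small_Un[OF reals.small_countable[OF E0(1)] reals.small_UN_countable] by blast
    show "\<exists>W. P G i W"
    proof (cases "coherent (Fam G i) \<and> seq_tree (tr i) \<and> branching (positive_sets (fst ` Fam G i)) (tr i)")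
      case True
      then interpret stage D lt S "Fam G i" using stage_if \<open>reals.small (Fam G i)\<close> by blast
      obtain f where f: "f \<in> branches (tr i)" "range f \<notin> ideal_of (fst ` Fam G i)"
        using positive_branch[of "tr i"] True by blast
      obtain W where W: "countable W" "infinite W" "coherent (Fam G i \<union> W)" "\<forall>Z\<in>fst ` W. Z \<subseteq> range f \<and> infinite Z \<and> (\<forall>A\<in>fst ` Fam G i. finite (Z \<inter> A))"
        using fresh[OF f(2)] by blast
      then have "{e \<in> W. fst e \<subseteq> range f} = W" by blast
      then have "infinite {e \<in> W. fst e \<subseteq> range f}" using W(2) by simp
      then show ?thesis using W(1,3) f(1) unfolding P_def by (intro exI[of _ W]) blast
    next
      case False
      then show ?thesis unfolding P_def by (intro exI[of _ "{}"]) auto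
    qed
  qed
  then obtain G where G: "\<And>i. P G i (G i)" by blast
  have Fam_mono: "Fam G j \<union> G j \<subseteq> Fam G i" if "j \<in> underS r i" for i j
  proof -
    have "underS r j \<subseteq> underS r i" using that underS_incr[of r j i] r(2)
      unfolding underS_def well_order_on_def linear_order_on_def partial_order_on_def preorder_on_def by blast
    then show ?thesis using that unfolding Fam_def by blast
  qed
  have union: "coherent (E0 \<union> (\<Union>j\<in>K. G j))" if K: "\<And>j. j \<in> K \<Longrightarrow> coherent (Fam G j \<union> G j)" for K
  proof (rule coherent_if_pairs)
    fix e e' assume e: "e \<in> E0 \<union> (\<Union>j\<in>K. G j)" "e' \<in> E0 \<union> (\<Union>j\<in>K. G j)"
    have E0_sub: "E0 \<subseteq> Fam G j" for j unfolding Fam_def by blast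
    consider "e \<in> E0" "e' \<in> E0" | j where "j \<in> K" "e \<in> G j" "e' \<in> E0" | j where "j \<in> K" "e \<in> E0" "e' \<in> G j"
      | j j' where "j \<in> K" "j' \<in> K" "e \<in> G j" "e' \<in> G j'" using e by blast
    then show "\<exists>E'. coherent E' \<and> e \<in> E' \<and> e' \<in> E'"
    proof cases
      case 1
      then show ?thesis using E0(3) by blast
    next
      case (2 j)
      then show ?thesis using K[of j] E0_sub[of j] by blast
    next
      case (3 j)
      then show ?thesis using K[of j] E0_sub[of j] by blast
    next
      case (4 j j')
      \<comment> \<open>The later of two stages contains the triples of both.\<close>
      have "j = j' \<or> j \<in> underS r j' \<or> j' \<in> underS r j"
        using r(2,3) unfolding well_order_on_def linear_order_on_def total_on_def underS_def by blast
      then show ?thesis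
        using 4 K[of j] K[of j'] Fam_mono[of j j'] Fam_mono[of j' j] by blast
    qed
  qed
  have "coherent (Fam G i)" for i
    using \<open>wf (r - Id)\<close>
  proof (induction i rule: wf_induct_rule)
    case (less i)
    have "coherent (Fam G j \<union> G j)" if "j \<in> underS r i" for j
      using less[of j] that G[of j] unfolding underS_def P_def by blast
    then show ?case unfolding Fam_def[of G i] by (rule union)
  qed
  then have G': "coherent (Fam G i \<union> G i)"
    "seq_tree (tr i) \<Longrightarrow> branching (positive_sets (fst ` Fam G i)) (tr i) \<Longrightarrow>
        (\<exists>f\<in>branches (tr i). infinite {e \<in> G i. fst e \<subseteq> range f})" for i
    using G[of i] unfolding P_def by blast+
  define E where "E = E0 \<union> (\<Union>j\<in>UNIV. G j)"
  have coh: "coherent E" unfolding E_def using G'(1) by (rule union)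
  have sub: "Fam G i \<subseteq> E" "G i \<subseteq> E" for i unfolding Fam_def E_def by auto
  have ad: "almost_disjoint (fst ` E)" by (rule coherent_almost_disjoint[OF coh])
  have inj: "inj_on fst E"
  proof (rule inj_onI, rule ccontr)
    fix e e' assume e: "e \<in> E" "e' \<in> E" "fst e = fst e'" "e \<noteq> e'"
    obtain A a y A' a' y' where "e = (A, a, y)" "e' = (A', a', y')" by (metis prod.collapse)
    then show False using e coh unfolding coherent_def by (metis Int_absorb fst_conv)
  qed
  have branch: "\<exists>f\<in>branches T. infinite {A \<in> fst ` E. A \<subseteq> range f}"
    if T: "seq_tree T" "branching (positive_sets (fst ` E)) T" for T
  proof -
    obtain i where i: "tr i = T" using tr by blast
    \<comment> \<open>Sets positive for the final ideal are positive at every earlier stage, so the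
      tree was treated there.\<close>
    have "ideal_of (fst ` Fam G i) \<subseteq> ideal_of (fst ` E)" using sub(1) by (intro ideal_of_mono image_mono)
    then have "branching (positive_sets (fst ` Fam G i)) (tr i)"
      using T(2) unfolding i branching_def positive_sets_def by blast
    then obtain f where f: "f \<in> branches T" "infinite {e \<in> G i. fst e \<subseteq> range f}"
      using G'(2)[of i] T(1) i by blast
    have "inj_on fst {e \<in> G i. fst e \<subseteq> range f}" using inj by (rule inj_on_subset) (use sub(2) in blast)
    then have "infinite (fst ` {e \<in> G i. fst e \<subseteq> range f})" using f(2) finite_imageD by blast
    moreover have "fst ` {e \<in> G i. fst e \<subseteq> range f} \<subseteq> {A \<in> fst ` E. A \<subseteq> range f}" using sub(2) by blast
    ultimately show ?thesis using f(1) finite_subset by blast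
  qed
  have "plus_Ramsey (fst ` E)"
    unfolding plus_Ramsey_def
  proof clarify
    fix T assume T: "seq_tree T" "branching (positive_sets (fst ` E)) T"
    obtain f where f: "f \<in> branches T" "infinite {A \<in> fst ` E. A \<subseteq> range f}" using branch[OF T] by blast
    have "{A \<in> fst ` E. A \<subseteq> range f} \<subseteq> {A \<in> fst ` E. infinite (A \<inter> range f)}"
      using ad unfolding almost_disjoint_def by (auto simp: inf_absorb1)
    then have "range f \<notin> ideal_of (fst ` E)"
      using f(2) finite_subset by (intro not_ideal_of_if_infinitely_many[OF ad]) blast
    then show "\<exists>f\<in>branches T. range f \<in> positive_sets (fst ` E)"
      using f(1) unfolding positive_sets_def by blast
  qed
  moreover have "infinite (fst ` E)"
    using E0(2) inj finite_imageD finite_subset[of E0 E] unfolding E_def by blast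
  moreover have "MAD (fst ` E)"
    unfolding MAD_def
  proof (intro conjI allI impI ad)
    fix \<B> assume \<B>: "almost_disjoint \<B> \<and> fst ` E \<subseteq> \<B>"
    show "\<B> = fst ` E"
    proof (rule ccontr)
      assume "\<B> \<noteq> fst ` E"
      then obtain C where C: "C \<in> \<B>" "C \<notin> fst ` E" using \<B> by blast
      have C_ad: "finite (C \<inter> A)" if "A \<in> fst ` E" for A
      proof -
        have "A \<in> \<B>" "A \<noteq> C" using that C \<B> by auto
        then show ?thesis using C(1) \<B> unfolding almost_disjoint_def by metis
      qed
      have "infinite C" using C(1) \<B> unfolding almost_disjoint_def by blast
      then have "C \<in> positive_sets (fst ` E)"
        using not_ideal_of_if_almost_disjoint[OF _ order_refl C_ad] unfolding positive_sets_def by blast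
      moreover have "suc_set (lists C) s = C" if "s \<in> lists C" for s using that unfolding suc_set_def by auto
      ultimately have "branching (positive_sets (fst ` E)) (lists C)" unfolding branching_def by simp
      moreover have "seq_tree (lists C)" unfolding seq_tree_def by (auto simp: prefix_def)
      ultimately obtain f where f: "f \<in> branches (lists C)" "infinite {A \<in> fst ` E. A \<subseteq> range f}"
        using branch[of "lists C"] by meson
      from infinite_imp_nonempty[OF f(2)] obtain A where A: "A \<in> fst ` E" "A \<subseteq> range f" by blast
      have "f k \<in> C" for k
      proof -
        have "map f [0..<Suc k] \<in> lists C" using f(1) unfolding branches_def by blast
        then show ?thesis by auto
      qed
      then have "C \<inter> A = A" using A(2) by blast
      then show False using C_ad[OF A(1)] A(1) ad unfolding almost_disjoint_def by metis
    qed
  qed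
  ultimately show ?thesis by blast
qed

end

section \<open>A dominating family of minimal size\<close>

definition dominating :: "(nat \<Rightarrow> nat) set \<Rightarrow> bool" where
  "dominating D \<longleftrightarrow> (\<forall>g. \<exists>f\<in>D. \<forall>\<^sub>\<infinity>n. g n \<le> f n)"

text \<open>The maximum of the first \<open>n + 1\<close> functions at \<open>n\<close> bounds each
  function from its index on.\<close>

lemma ex_eventual_upper_bound:
  fixes G :: "nat \<Rightarrow> nat \<Rightarrow> nat"
  shows "\<exists>g. \<forall>i. \<forall>\<^sub>\<infinity>n. G i n \<le> g n"
proof (intro exI allI)
  fix i
  have "G i n \<le> Max ((\<lambda>i. G i n) ` {..n})" if "i \<le> n" for n using that by (intro Max_ge) auto
  then show "\<forall>\<^sub>\<infinity>n. G i n \<le> Max ((\<lambda>i. G i n) ` {..n})" unfolding MOST_nat_le by blast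
qed

lemma dominating_uncountable:
  assumes "dominating D"
  shows "|UNIV :: nat set| <o |D|"
proof -
  have "\<not> |D| \<le>o |UNIV :: nat set|"
  proof
    assume "|D| \<le>o |UNIV :: nat set|"
    then have "countable D" unfolding countable_def by (meson card_of_ordLeq)
    moreover have "D \<noteq> {}" using assms unfolding dominating_def by blast
    ultimately obtain h where h: "D = range (h :: nat \<Rightarrow> nat \<Rightarrow> nat)" by (metis range_from_nat_into)
    obtain g where g: "\<forall>i. \<forall>\<^sub>\<infinity>n. Suc (h i n) \<le> g n" using ex_eventual_upper_bound[of "\<lambda>i n. Suc (h i n)"] by blast
    obtain i where "\<forall>\<^sub>\<infinity>n. g n \<le> h i n" using assms unfolding dominating_def h by blast
    with g have "\<forall>\<^sub>\<infinity>n. Suc (h i n) \<le> g n \<and> g n \<le> h i n" by (simp add: eventually_conj_iff)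
    then obtain n where "Suc (h i n) \<le> g n \<and> g n \<le> h i n" unfolding MOST_nat_le by blast
    then show False by linarith
  qed
  then show ?thesis by (simp add: card_of_Well_order not_ordLeq_iff_ordLess)
qed

lemma ex_minimal_dominating:
  obtains D where "dominating D" "\<And>H :: (nat \<Rightarrow> nat) set. |H| <o |D| \<Longrightarrow> \<exists>g. \<forall>h\<in>H. \<exists>\<^sub>\<infinity>n. h n < g n"
proof -
  have "dominating UNIV" unfolding dominating_def by (metis UNIV_I MOST_I order_refl)
  then have "card_of ` Collect dominating \<noteq> {}" by blast
  from exists_minim_Card_order[OF this] obtain D where D: "dominating D" "\<And>H. dominating H \<Longrightarrow> |D| \<le>o |H|"
    using card_of_Card_order by blast
  have "\<exists>g. \<forall>h\<in>H. \<exists>\<^sub>\<infinity>n. h n < g n" if "|H| <o |D|" for H :: "(nat \<Rightarrow> nat) set"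
  proof -
    have "\<not> dominating H" using D(2) that not_ordLess_ordLeq by blast
    then obtain g where "\<forall>h\<in>H. \<not> (\<forall>\<^sub>\<infinity>n. g n \<le> h n)" unfolding dominating_def by blast
    then show ?thesis unfolding not_eventually not_le by blast
  qed
  then show ?thesis using that D(1) by blast
qed

section \<open>Interval partitions from dominating functions as splitting sets\<close>

fun cut_points :: "(nat \<Rightarrow> nat) \<Rightarrow> nat \<Rightarrow> nat" where
  "cut_points f 0 = 0"
| "cut_points f (Suc k) = max (f (cut_points f k)) (Suc (cut_points f k))"

definition even_blocks :: "(nat \<Rightarrow> nat) \<Rightarrow> nat set" where
  "even_blocks f = {m. \<exists>k. even k \<and> cut_points f k \<le> m \<and> m < cut_points f (Suc k)}"

lemma strict_mono_cut_points: "strict_mono (cut_points f)"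
  by (simp add: strict_mono_Suc_iff less_max_iff_disj)

lemma in_even_blocks_iff:
  assumes "cut_points f k \<le> m" "m < cut_points f (Suc k)"
  shows "m \<in> even_blocks f \<longleftrightarrow> even k"
proof -
  have "j = k" if "cut_points f j \<le> m" "m < cut_points f (Suc j)" for j
  proof (rule ccontr)
    assume "j \<noteq> k"
    then have "Suc j \<le> k \<or> Suc k \<le> j" by linarith
    then have "cut_points f (Suc j) \<le> cut_points f k \<or> cut_points f (Suc k) \<le> cut_points f j"
      using strict_mono_less_eq[OF strict_mono_cut_points] by blast
    then show False using that assms by linarith
  qed
  then show ?thesis using assms unfolding even_blocks_def by blast
qed

text \<open>Choose \<open>f\<close> in \<open>D\<close> above all next-element functions of the sets
  \<open>X n\<close>. Then each \<open>X n\<close> meets all but finitely many of the intervals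
  between consecutive cut points of \<open>f\<close>, hence infinitely many of either
  parity.\<close>

lemma even_blocks_splitting:
  fixes X :: "nat \<Rightarrow> nat set"
  assumes D: "dominating D" and X: "\<And>n. infinite (X n)"
  shows "\<exists>f\<in>D. \<forall>n. infinite (X n \<inter> even_blocks f) \<and> infinite (X n - even_blocks f)"
proof -
  have "\<exists>x. x \<in> X n \<and> m \<le> x" for n m
    using X[of n] unfolding infinite_nat_iff_unbounded_le by blast
  then obtain nx where nx: "\<And>n m. nx n m \<in> X n \<and> m \<le> nx n m" by metis
  obtain g where g: "\<forall>i. \<forall>\<^sub>\<infinity>n. Suc (nx i n) \<le> g n" using ex_eventual_upper_bound[of "\<lambda>i n. Suc (nx i n)"] by blast
  obtain f where f: "f \<in> D" "\<forall>\<^sub>\<infinity>n. g n \<le> f n" using D unfolding dominating_def by blast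
  have inf: "infinite {x \<in> X n. x \<in> even_blocks f \<longleftrightarrow> b}" for n b
    unfolding infinite_nat_iff_unbounded
  proof
    fix m
    have "\<forall>\<^sub>\<infinity>k. nx n k < f k" using g[rule_format, of n] f(2) by eventually_elim simp
    then obtain N where N: "\<And>k. N \<le> k \<Longrightarrow> nx n k < f k" unfolding MOST_nat_le by blast
    \<comment> \<open>The interval index has the wanted parity and is large enough to lie beyond
      both \<open>N\<close> and \<open>m\<close>.\<close>
    define k where "k = 2 * (Suc m + N) + (if b then 0 else 1)"
    let ?x = "nx n (cut_points f k)"
    have "k \<le> cut_points f k" using strict_mono_imp_increasing[OF strict_mono_cut_points] .
    then have k: "N \<le> cut_points f k" "m < cut_points f k" unfolding k_def by auto
    have x: "?x \<in> X n" "cut_points f k \<le> ?x" "?x < cut_points f (Suc k)"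
      using nx[of n "cut_points f k"] N[OF k(1)] by auto
    have "even k \<longleftrightarrow> b" unfolding k_def by simp
    then have "?x \<in> even_blocks f \<longleftrightarrow> b" using in_even_blocks_iff[OF x(2,3)] by (rule trans[rotated])
    then show "\<exists>x>m. x \<in> {x \<in> X n. x \<in> even_blocks f \<longleftrightarrow> b}" using x k(2) by (intro exI[of _ ?x]) auto
  qed
  have "infinite (X n \<inter> even_blocks f) \<and> infinite (X n - even_blocks f)" for n
    using inf[of n True] inf[of n False] by (simp add: Int_def set_diff_eq)
  then show ?thesis using f(1) by blast
qed

theorem theorem23:
  shows "\<exists>\<A>. MAD \<A> \<and> infinite \<A> \<and> plus_Ramsey \<A>"
proof -
  obtain D where D: "dominating D" "\<And>H :: (nat \<Rightarrow> nat) set. |H| <o |D| \<Longrightarrow> \<exists>g. \<forall>h\<in>H. \<exists>\<^sub>\<infinity>n. h n < g n"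
    by (rule ex_minimal_dominating) blast
  interpret nondominated D
    by unfold_locales (use dominating_uncountable[OF D(1)] D(2) in auto)
  show ?thesis
  proof (cases "\<exists>\<A>. MAD \<A> \<and> infinite \<A> \<and> small \<A>")
    case True
    then show ?thesis using small_MAD_plus_Ramsey by blast
  next
    case False
    let ?r = "|D|"
    define lt where "lt a b \<longleftrightarrow> (a, b) \<in> ?r \<and> a \<noteq> b" for a b
    have r: "well_order_on D ?r" by (rule card_of_well_order_on)
    then have total: "total_on D ?r" and trans: "trans ?r" and antisym: "antisym ?r" and wf: "wf (?r - Id)"
      unfolding well_order_on_def linear_order_on_def partial_order_on_def preorder_on_def by blast+
    have small_below: "small {b \<in> D. lt b a}" if "a \<in> D" for a
    proof -
      have "|underS ?r a| <o ?r" using that by (intro card_of_underS) (simp_all add: card_of_card_order_on Field_card_of)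
      moreover have "{b \<in> D. lt b a} \<subseteq> underS ?r a" unfolding lt_def underS_def by blast
      ultimately show ?thesis unfolding small_def by (meson card_of_mono1 ordLeq_ordLess_trans)
    qed
    \<comment> \<open>For each \<open>c\<close> in \<open>C\<close> the functions up to
      \<open>c\<close> are too few to dominate, as \<open>\<gamma> c\<close> witnesses. Some
      \<open>f\<close> in \<open>D\<close> dominates all these countably many witnesses; were
      \<open>C\<close> unbounded, \<open>f\<close> would lie at or below some \<open>c\<close>,
      contradicting the choice of \<open>\<gamma> c\<close>.\<close>
    have bounded: "\<exists>a\<in>D. \<forall>c\<in>C. lt c a" if C: "countable C" "C \<subseteq> D" for C
    proof (rule ccontr)
      assume unbounded: "\<not> ?thesis"
      have "D \<noteq> {}" using D(1) unfolding dominating_def by blast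
      then have "C \<noteq> {}" using unbounded by blast
      have "small (insert c {b \<in> D. lt b c})" if "c \<in> C" for c
        using small_Un[OF small_countable[of "{c}"] small_below[of c]] that C(2) by auto
      then have "\<forall>c\<in>C. \<exists>g. \<forall>h\<in>insert c {b \<in> D. lt b c}. \<exists>\<^sub>\<infinity>n. h n < g n"
        using D(2) unfolding small_def by blast
      from bchoice[OF this] obtain \<gamma> where
        \<gamma>: "\<forall>c\<in>C. \<forall>h\<in>insert c {b \<in> D. lt b c}. \<exists>\<^sub>\<infinity>n. h n < \<gamma> c n" ..
      obtain g where g: "\<forall>i. \<forall>\<^sub>\<infinity>n. \<gamma> (from_nat_into C i) n \<le> g n"
        using ex_eventual_upper_bound[of "\<lambda>i. \<gamma> (from_nat_into C i)"] by blast
      obtain f where f: "f \<in> D" "\<forall>\<^sub>\<infinity>n. g n \<le> f n" using D(1) unfolding dominating_def by blast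
      obtain c where c: "c \<in> C" "\<not> lt c f" using unbounded f(1) by blast
      then have "f \<in> insert c {b \<in> D. lt b c}" using total f(1) C(2) unfolding total_on_def lt_def by blast
      then have *: "\<exists>\<^sub>\<infinity>n. f n < \<gamma> c n" by (rule bspec[OF bspec[OF \<gamma> c(1)]])
      obtain i where "from_nat_into C i = c" using from_nat_into_surj[OF C(1) c(1)] ..
      then have "\<forall>\<^sub>\<infinity>n. \<gamma> c n \<le> g n" using g by blast
      with f(2) have "\<forall>\<^sub>\<infinity>n. \<not> f n < \<gamma> c n" by eventually_elim simp
      then show False using * unfolding frequently_def by blast
    qed
    interpret splitting_index D lt even_blocks
    proof
      show "\<exists>m\<in>D. P m \<and> (\<forall>b\<in>D. lt b m \<longrightarrow> \<not> P b)" if "a \<in> D" "P a" for a P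
      proof -
        have "a \<in> {a \<in> D. P a}" using that by simp
        then obtain m where "m \<in> {a \<in> D. P a}" "\<forall>b. (b, m) \<in> ?r - Id \<longrightarrow> b \<notin> {a \<in> D. P a}"
          using wf unfolding wf_eq_minimal by metis
        then show ?thesis unfolding lt_def by (intro bexI[of _ m]) auto
      qed
      show "lt a c" if "lt a b" "lt b c" for a b c
        using that trans antisym unfolding lt_def by (metis antisymD transD)
      show "lt a b \<or> a = b \<or> lt b a" if "a \<in> D" "b \<in> D" for a b
        using that total unfolding lt_def total_on_def by blast
      show "\<exists>a\<in>D. \<forall>c\<in>C. lt c a" if "countable C" "C \<subseteq> D" for C using bounded[OF that] .
      show "small {b \<in> D. lt b a}" if "a \<in> D" for a using small_below[OF that] .
      show "\<exists>a\<in>D. \<forall>n. infinite (X n \<inter> even_blocks a) \<and> infinite (X n - even_blocks a)"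
        if "\<And>n :: nat. infinite (X n)" for X using even_blocks_splitting[OF D(1) that] .
      show "\<not> small \<A>" if "MAD \<A>" "infinite \<A>" for \<A> using False that by blast
    qed
    show ?thesis by (rule plus_Ramsey_MAD)
  qed
qed

end
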